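(* Let $\mu$ be a non-zero, finite, compactly supported Borel measure on $\mathbb{R}^d$ with $\dim_{\mathrm S}\mu<d$. If $$q>4+\frac{4(d-\dim_{\mathrm S}\mu)}{\dim_{\mathrm F}\mu},$$ then for all $f\in L^2(\mu)$, $$\|\widehat{f\mu}\|_{L^q(\mathbb{R}^d)}\lesssim\|f\|_{L^2(\mu)}.$$ Equivalently, if $$1\leq q'<1+\frac{\dim_{\mathrm F}\mu}{4(d-\dim_{\mathrm S}\mu+\dim_{\mathrm F}\mu)-\dim_{\mathrm F}\mu},$$ then for all $f\in L^{q'}(\mathbb{R}^d)$, $$\|\widehat f\,\|_{L^2(\mu)}\lesssim\|f\|_{L^{q'}(\mathbb{R}^d)}.$$
   Context: $A\lesssim B$ means $A\leq CB$ with a constant $C>0$ independent of $f$. $q'$ is the conjugate exponent of $q$. Fourier transforms: $\widehat f(\xi)=\int_{\mathbb{R}^d}e^{-2\pi i\xi\cdot x}f(x)\,dx$, $\widehat\mu(\xi)=\int e^{-2\pi i\xi\cdot x}\,d\mu(x)$, $\widehat{f\mu}(\xi)=\int e^{-2\pi i\xi\cdot x}f(x)\,d\mu(x)$. The estimate for $\|\widehat f\,\|_{L^2(\mu)}$ is understood as an estimate for Schwartz functions $f$, extended by density. Sobolev dimension: $\dim_{\mathrm S}\mu=\sup\{s\in\mathbb{R}:\int_{\mathbb{R}^d}|\widehat\mu(\xi)|^2|\xi|^{s-d}\,d\xi<\infty\}$ (with value $0$ if the set is empty). Fourier dimension: $\dim_{\mathrm F}\mu=\sup\{s\in\mathbb{R}:\sup_{\xi\in\mathbb{R}^d}|\widehat\mu(\xi)|^2|\xi|^s<\infty\}$.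 If $\dim_{\mathrm F}\mu=0$ the right-hand side of the condition on $q$ is $+\infty$ and the statement is vacuous. *)

theory Defs
  imports "HOL-Analysis.Analysis" "HOL-Probability.Essential_Supremum"
begin

text \<open>The Fourier transform of the complex measure \<open>f M\<close>. The transform of \<open>M\<close> itself is
  the case \<open>f = (\<lambda>_. 1)\<close>, that of a function \<open>f\<close> is the case \<open>M = lborel\<close>.\<close>

definition fourier :: "'a::euclidean_space measure \<Rightarrow> ('a \<Rightarrow> complex) \<Rightarrow> 'a \<Rightarrow> complex" where
  "fourier M f \<xi> = (LINT x|M. exp (- 2 * of_real pi * \<i> * of_real (\<xi> \<bullet> x)) * f x)"

text \<open>In the next two definitions \<open>norm \<xi> powr t\<close> is \<open>0\<close> at \<open>\<xi> = 0\<close> for every \<open>t\<close>. This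
  changes neither dimension of a non-zero finite measure: the origin is a Lebesgue null set, and
  for \<open>t < 0\<close> the supremum is infinite already because of the points near the origin.\<close>

definition sobolev_dim :: "'a::euclidean_space measure \<Rightarrow> ereal" where
  "sobolev_dim M =
    (let S = {s::real. (\<integral>\<^sup>+\<xi>. ennreal ((norm (fourier M (\<lambda>_. 1) \<xi>))\<^sup>2
                          * norm \<xi> powr (s - real DIM('a))) \<partial>lborel) < \<infinity>}
     in if S = {} then 0 else (SUP s\<in>S. ereal s))"

definition fourier_dim :: "'a::euclidean_space measure \<Rightarrow> ereal" where
  "fourier_dim M =
    (SUP s\<in>{s::real. bdd_above (range (\<lambda>\<xi>. (norm (fourier M (\<lambda>_. 1) \<xi>))\<^sup>2 * norm \<xi> powr s))}.
       ereal s)"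

text \<open>Lebesgue spaces of complex functions, for exponents \<open>1 \<le> p \<le> \<infinity>\<close>. The value of
  \<open>Lp_norm\<close> is meaningful only on members of \<open>Lp\<close>.\<close>

definition Lp :: "'a measure \<Rightarrow> ereal \<Rightarrow> ('a \<Rightarrow> complex) set" where
  "Lp M p = {f \<in> borel_measurable M.
     if p = \<infinity> then esssup M (\<lambda>x. ennreal (norm (f x))) < \<infinity>
     else integrable M (\<lambda>x. norm (f x) powr real_of_ereal p)}"

definition Lp_norm :: "'a measure \<Rightarrow> ereal \<Rightarrow> ('a \<Rightarrow> complex) \<Rightarrow> real" where
  "Lp_norm M p f =
     (if p = \<infinity> then enn2real (esssup M (\<lambda>x. ennreal (norm (f x))))
      else (LINT x|M. norm (f x) powr real_of_ereal p) powr (1 / real_of_ereal p))"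

definition conjugate_exponents :: "ereal \<Rightarrow> ereal \<Rightarrow> bool" where
  "conjugate_exponents p q \<longleftrightarrow> 1 \<le> p \<and> 1 \<le> q \<and> 1 / p + 1 / q = 1"

fun iterated_derivative :: "'a::euclidean_space list \<Rightarrow> ('a \<Rightarrow> complex) \<Rightarrow> 'a \<Rightarrow> complex" where
  "iterated_derivative [] f = f"
| "iterated_derivative (b # bs) f =
     (\<lambda>x. frechet_derivative (iterated_derivative bs f) (at x) b)"

text \<open>All iterated partial derivatives being differentiable everywhere amounts to smoothness.\<close>

definition schwartz :: "('a::euclidean_space \<Rightarrow> complex) \<Rightarrow> bool" where
  "schwartz f \<longleftrightarrow>
    (\<forall>bs. set bs \<subseteq> Basis \<longrightarrow>
       (\<forall>x. iterated_derivative bs f differentiable at x) \<and>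
       (\<forall>N::nat. bounded (range (\<lambda>x. norm x ^ N *\<^sub>R iterated_derivative bs f x))))"

text \<open>The function \<open>g\<close> is a value at \<open>f\<close> of the extension by density, to a partial map from
  \<open>L\<^sup>p\<close> of Lebesgue measure to \<open>L\<^sup>2(M)\<close>, of the Fourier transform of Schwartz functions
  (the closure of its graph).\<close>

definition fourier_extension ::
  "'a::euclidean_space measure \<Rightarrow> ereal \<Rightarrow> ('a \<Rightarrow> complex) \<Rightarrow> ('a \<Rightarrow> complex) \<Rightarrow> bool" where
  "fourier_extension M p f g \<longleftrightarrow>
     f \<in> Lp lborel p \<and> g \<in> Lp M 2 \<and>
     (\<exists>\<phi>::nat \<Rightarrow> 'a \<Rightarrow> complex. (\<forall>n. schwartz (\<phi> n)) \<and>
        (\<lambda>n. Lp_norm lborel p (\<lambda>x. \<phi> n x - f x)) \<longlonglongrightarrow> 0 \<and>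
        (\<lambda>n. Lp_norm M 2 (\<lambda>x. fourier lborel (\<phi> n) x - g x)) \<longlonglongrightarrow> 0)"

end

(* Write h for the transform of mu. Decay of h and finiteness of its energy integral combine to
   h in L^(q/2): |h|^(q/2) is at most a constant times |h|^2 |xi|^(s-d) as soon as q/2 exceeds
   2 + 2(d-s)/beta. By T T*, the square of the norm of the Fourier transform of g in L^2(mu) is the
   double integral of g(x) cnj(g(y)) h(x-y), which Young's inequality bounds by the square of the
   norm of g in L^(q'). Duality gives the extension estimate. The restriction estimate is
   extended from the dense class of Schwartz functions; a crude quasi-triangle inequality for p-th
   powers replaces Minkowski's inequality throughout, at the price of a larger constant. *)
theory Submission
  imports Defs
begin

section \<open>The Fourier transform and the \<open>T T\<^sup>*\<close> argument\<close>

text \<open>The threshold comes from |h|^r = |h|^2 |h|^(r-2): when |h|^2 is at most a constant times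
  |\<xi>|^(-\<beta>), the second factor is dominated by |\<xi>|^(s-d) once \<beta>(r-2)/2 >= d-s.
  The exponent doubles because Young's inequality with g twice in L^p and h in L^(q/2) requires 2/p
  + 2/q = 2, so that p = q' and q = 2r. The dimensions are suprema that need not be attained; the
  strict inequality in the hypothesis leaves room for exponents slightly below both. Since the
  transform on L^p exists only as an extension by density, the estimate is proved for g in both L^1
  and L^p, where the transform is an integral; this class contains the Schwartz functions and also
  the truncated extremal function of the duality argument. Density rests on bumps exp(-Q) with Q a
  polynomial: their derivatives of all orders stay in one algebraic class, and their limits are
  indicators of boxes, which generate the Borel sets.\<close>

definition wave :: "real \<Rightarrow> complex" where
  "wave t = exp (- 2 * of_real pi * \<i> * of_real t)"

lemma fourier_eq: "fourier M f \<xi> = (LINT x|M. wave (\<xi> \<bullet> x) * f x)"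
  by (simp add: fourier_def wave_def)

lemma norm_wave [simp]: "norm (wave t) = 1"
  by (simp add: wave_def)

lemma wave_measurable [measurable]: "wave \<in> borel_measurable borel"
  unfolding wave_def by (intro borel_measurable_continuous_onI continuous_intros)

lemma cnj_measurable [measurable]: "cnj \<in> borel_measurable borel"
  by (intro borel_measurable_continuous_onI continuous_intros)

lemma wave_add: "wave (s + t) = wave s * wave t"
  by (simp add: wave_def distrib_left mult_exp_exp)

lemma cnj_wave: "cnj (wave t) = wave (- t)"
  by (simp add: wave_def exp_cnj)

text \<open>The character is unimodular. As a simp rule this reduces the integrability conditions of
  the Fubini arguments to those of the plain densities.\<close>

lemma integrable_wave_mult_iff [simp]:
  assumes [measurable]: "g \<in> borel_measurable M" "f \<in> borel_measurable M"
  shows "integrable M (\<lambda>x. wave (g x) * f x) \<longleftrightarrow> integrable M f"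
  by (simp add: integrable_iff_bounded norm_mult)

lemma norm_fourier_le: "norm (fourier M f \<xi>) \<le> (LINT x|M. norm (f x))"
  unfolding fourier_eq
  by (rule order_trans[OF integral_norm_bound]) (simp add: norm_mult)

lemma fourier_minus_arg: "fourier M (\<lambda>x. cnj (f x)) (- \<xi>) = cnj (fourier M f \<xi>)"
proof -
  have "cnj (fourier M f \<xi>) = (LINT x|M. cnj (wave (\<xi> \<bullet> x) * f x))"
    unfolding fourier_eq by (rule Bochner_Integration.integral_cnj[symmetric])
  then show ?thesis by (simp add: fourier_eq cnj_wave)
qed

lemma fourier_diff:
  assumes "sets M = sets borel" "integrable M f" "integrable M g"
  shows "fourier M (\<lambda>x. f x - g x) \<xi> = fourier M f \<xi> - fourier M g \<xi>"
proof -
  note assms(1)[measurable_cong]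
  have [measurable]: "f \<in> borel_measurable M" "g \<in> borel_measurable M"
    using assms by auto
  show ?thesis unfolding fourier_eq right_diff_distrib
    by (intro Bochner_Integration.integral_diff) (use assms in simp_all)
qed

lemma fourier_measurable:
  fixes M :: "'a::euclidean_space measure"
  assumes "sigma_finite_measure M" and M: "sets M = sets borel" and [measurable]: "f \<in> borel_measurable M"
  shows "fourier M f \<in> borel_measurable borel"
proof -
  interpret sigma_finite_measure M by fact
  note M[measurable_cong]
  have "(\<lambda>\<xi>. LINT x|M. wave (\<xi> \<bullet> x) * f x) \<in> borel_measurable borel"
    by (rule borel_measurable_lebesgue_integral) measurable
  then show ?thesis by (simp add: fourier_eq[abs_def])
qed

locale finite_borel_measure = finite_measure M for M :: "'a::euclidean_space measure" +
  assumes sets_eq_borel [measurable_cong, simp]: "sets M = sets borel"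
begin

lemma fourier_borel_measurable [measurable]:
  "f \<in> borel_measurable M \<Longrightarrow> fourier M f \<in> borel_measurable borel"
  by (rule fourier_measurable[OF sigma_finite_measure_axioms]) auto

lemma fourier_lborel_borel_measurable [measurable]:
  "f \<in> borel_measurable borel \<Longrightarrow> fourier lborel f \<in> borel_measurable borel"
  by (rule fourier_measurable[OF lborel.sigma_finite_measure_axioms]) auto

lemma integrable_bounded:
  fixes f :: "'a \<Rightarrow> 'b::{banach, second_countable_topology}"
  assumes [measurable]: "f \<in> borel_measurable borel" and "\<And>x. norm (f x) \<le> B"
  shows "integrable M f"
  by (rule integrable_const_bound[of _ B]) (use assms in auto)

text \<open>The multiplication formula: both sides are iterated integrals of
  \<open>wave (x \<bullet> \<xi>) * f \<xi> * g x\<close>, whose modulus is a product of two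
  integrable functions. It carries the restriction estimate over to the extension estimate.\<close>

lemma fourier_duality:
  assumes f: "integrable M f" and g: "integrable lborel g"
  shows "(LINT x|lborel. fourier M f x * g x) = (LINT \<xi>|M. f \<xi> * fourier lborel g \<xi>)"
proof -
  have [measurable]: "f \<in> borel_measurable M" "g \<in> borel_measurable borel"
    using f g by auto
  interpret P: pair_sigma_finite M "lborel :: 'a measure" ..
  have "integrable (M \<Otimes>\<^sub>M lborel) (\<lambda>(\<xi>, x). wave (x \<bullet> \<xi>) * f \<xi> * g x)"
  proof (rule P.Fubini_integrable)
    show "integrable M (\<lambda>\<xi>. LINT x|lborel. norm (case (\<xi>, x) of (\<xi>, x) \<Rightarrow> wave (x \<bullet> \<xi>) * f \<xi> * g x))"
      using f by (simp add: norm_mult)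
    show "AE \<xi> in M. integrable lborel (\<lambda>x. case (\<xi>, x) of (\<xi>, x) \<Rightarrow> wave (x \<bullet> \<xi>) * f \<xi> * g x)"
      using g by (simp add: mult.assoc)
  qed measurable
  from P.Fubini_integral[OF this] show ?thesis
    by (simp add: fourier_eq inner_commute flip: integral_mult_left_zero integral_mult_right_zero)
      (simp add: ac_simps)
qed

text \<open>The measure is positive, so its transform is Hermitian. Evenness of the modulus lets the
  kernel at \<open>x - y\<close> be integrated in either variable.\<close>

lemma norm_transform_one_minus: "norm (fourier M (\<lambda>_. 1) (- \<xi>)) = norm (fourier M (\<lambda>_. 1) \<xi>)"
  using fourier_minus_arg[of M "\<lambda>_. 1" \<xi>] by simp

lemma norm_transform_one_le: "norm (fourier M (\<lambda>_. 1) \<xi>) \<le> measure M (space M)"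
  using norm_fourier_le[of M "\<lambda>_. 1" \<xi>] by simp

text \<open>The \<open>T T\<^sup>*\<close> identity, in the form of an inequality: the square of the transform at \<open>\<xi>\<close> is a double
  integral whose \<open>\<xi>\<close>-dependence is a character in \<open>x - y\<close>.\<close>

lemma fourier_square_le:
  assumes g: "integrable lborel g"
  shows "(\<integral>\<^sup>+\<xi>. ennreal ((norm (fourier lborel g \<xi>))\<^sup>2) \<partial>M)
    \<le> (\<integral>\<^sup>+x. \<integral>\<^sup>+y. ennreal (norm (g x) * norm (g y) * norm (fourier M (\<lambda>_. 1) (x - y))) \<partial>lborel \<partial>lborel)"
    (is "_ \<le> ?R")
proof -
  let ?P = "lborel \<Otimes>\<^sub>M lborel :: ('a \<times> 'a) measure"
  have g1 [measurable]: "g \<in> borel_measurable borel"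
    using g by auto
  interpret P: pair_sigma_finite M ?P
    by (simp add: pair_sigma_finite_def sigma_finite_measure_axioms
        lborel_pair.P.sigma_finite_measure_axioms)
  define G where "G = (\<lambda>(x, y). g x * cnj (g y))"
  have G [measurable]: "G \<in> borel_measurable ?P" unfolding G_def by measurable
  have Gi: "integrable ?P G"
    unfolding G_def
  proof (rule lborel_pair.Fubini_integrable)
    show "integrable lborel (\<lambda>x. LINT y|lborel. norm (case (x, y) of (x, y) \<Rightarrow> g x * cnj (g y)))"
      using g by (simp add: norm_mult)
    show "AE x in lborel. integrable lborel (\<lambda>y. case (x, y) of (x, y) \<Rightarrow> g x * cnj (g y))"
      using g by simp
  qed measurable
  have sq: "complex_of_real ((norm (fourier lborel g \<xi>))\<^sup>2) = (LINT z|?P. wave (\<xi> \<bullet> (fst z - snd z)) * G z)"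
    for \<xi>
  proof -
    have i: "integrable ?P (\<lambda>(x, y). wave (\<xi> \<bullet> (x - y)) * (g x * cnj (g y)))"
      using Gi by (simp add: G_def case_prod_unfold)
    have "complex_of_real ((norm (fourier lborel g \<xi>))\<^sup>2) = fourier lborel g \<xi> * cnj (fourier lborel g \<xi>)"
      by (rule complex_norm_square)
    also have "\<dots> = (LINT x|lborel. wave (\<xi> \<bullet> x) * g x * cnj (fourier lborel g \<xi>))"
      by (simp add: fourier_eq)
    also have "\<dots> = (LINT x|lborel. LINT y|lborel. wave (\<xi> \<bullet> x) * g x * cnj (wave (\<xi> \<bullet> y) * g y))"
      unfolding fourier_eq Bochner_Integration.integral_cnj[symmetric] by simp
    also have "\<dots> = (LINT x|lborel. LINT y|lborel. wave (\<xi> \<bullet> (x - y)) * (g x * cnj (g y)))"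
    proof -
      have "wave (\<xi> \<bullet> x) * g x * cnj (wave (\<xi> \<bullet> y) * g y) = wave (\<xi> \<bullet> (x - y)) * (g x * cnj (g y))" for x y
        using wave_add[of "\<xi> \<bullet> x" "- (\<xi> \<bullet> y)"]
        by (simp add: cnj_wave inner_diff_right)
      then show ?thesis by (simp only:)
    qed
    also have "\<dots> = (LINT z|?P. wave (\<xi> \<bullet> (fst z - snd z)) * G z)"
      using lborel_pair.integral_fst[OF i] by (simp add: G_def case_prod_unfold)
    finally show ?thesis .
  qed
  have i2: "integrable (M \<Otimes>\<^sub>M ?P) (\<lambda>(\<xi>, z). wave (\<xi> \<bullet> (fst z - snd z)) * G z)"
  proof (rule P.Fubini_integrable)
    show "integrable M (\<lambda>\<xi>. LINT z|?P. norm (case (\<xi>, z) of (\<xi>, z) \<Rightarrow> wave (\<xi> \<bullet> (fst z - snd z)) * G z))"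
      by (simp add: norm_mult)
    show "AE \<xi> in M. integrable ?P (\<lambda>z. case (\<xi>, z) of (\<xi>, z) \<Rightarrow> wave (\<xi> \<bullet> (fst z - snd z)) * G z)"
      using Gi by simp
  qed measurable
  have bd: "norm (fourier lborel g \<xi>) \<le> (LINT x|lborel. norm (g x))" for \<xi>
    by (rule norm_fourier_le)
  have sqi: "integrable M (\<lambda>\<xi>. (norm (fourier lborel g \<xi>))\<^sup>2)"
    by (rule integrable_bounded[of _ "(LINT x|lborel. norm (g x))\<^sup>2"]) (use bd in \<open>auto intro: power_mono\<close>)
  have h [measurable]: "fourier M (\<lambda>_. 1) \<in> borel_measurable borel" by simp
  have "complex_of_real (LINT \<xi>|M. (norm (fourier lborel g \<xi>))\<^sup>2)
      = (LINT \<xi>|M. complex_of_real ((norm (fourier lborel g \<xi>))\<^sup>2))"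
    by (rule integral_complex_of_real[symmetric])
  also have "\<dots> = (LINT \<xi>|M. LINT z|?P. wave (\<xi> \<bullet> (fst z - snd z)) * G z)"
    by (simp only: sq)
  \<comment> \<open>After the exchange the inner integral over \<xi> is the transform of
    \<open>M\<close> at the difference of the two points.\<close>
  also have "\<dots> = (LINT z|?P. LINT \<xi>|M. wave (\<xi> \<bullet> (fst z - snd z)) * G z)"
    using P.Fubini_integral[OF i2] by simp
  also have "\<dots> = (LINT z|?P. fourier M (\<lambda>_. 1) (fst z - snd z) * G z)"
    by (simp add: fourier_eq inner_commute)
  finally have eq: "complex_of_real (LINT \<xi>|M. (norm (fourier lborel g \<xi>))\<^sup>2)
      = (LINT z|?P. fourier M (\<lambda>_. 1) (fst z - snd z) * G z)" .
  \<comment> \<open>The complex integral equals a nonnegative real, so taking its modulus loses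
    nothing; only moving the modulus inside does.\<close>
  have "ennreal (LINT \<xi>|M. (norm (fourier lborel g \<xi>))\<^sup>2)
      = ennreal (norm (LINT z|?P. fourier M (\<lambda>_. 1) (fst z - snd z) * G z))"
    unfolding eq[symmetric] norm_of_real by (subst abs_of_nonneg) auto
  also have "\<dots> \<le> (\<integral>\<^sup>+z. ennreal (norm (fourier M (\<lambda>_. 1) (fst z - snd z) * G z)) \<partial>?P)"
  proof (rule integral_norm_bound_ennreal)
    show "integrable ?P (\<lambda>z. fourier M (\<lambda>_. 1) (fst z - snd z) * G z)"
    proof (rule Bochner_Integration.integrable_bound)
      show "integrable ?P (\<lambda>z. measure M (space M) * norm (G z))" using Gi by simp
      show "AE z in ?P. norm (fourier M (\<lambda>_. 1) (fst z - snd z) * G z) \<le> norm (measure M (space M) * norm (G z))"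
        by (intro always_eventually allI) (auto simp: norm_mult intro: mult_right_mono norm_transform_one_le)
    qed measurable
  qed
  also have "\<dots> = ?R"
    by (subst lborel.nn_integral_fst[symmetric]) (auto simp: G_def norm_mult ac_simps)
  finally show ?thesis
    by (subst nn_integral_eq_integral[OF sqi]) auto
qed

end

section \<open>Cauchy-Schwarz, Young's inequality and the restriction estimate\<close>

text \<open>The version for nonnegative integrals is applied to the moduli; its finite right side
  also yields the integrability of the product, which bounding the modulus of the integral
  requires.\<close>

lemma Cauchy_Schwarz_integral_norm:
  fixes f k :: "'a \<Rightarrow> complex"
  assumes [measurable]: "f \<in> borel_measurable M" "k \<in> borel_measurable M"
    and f: "integrable M (\<lambda>x. (norm (f x))\<^sup>2)" and k: "integrable M (\<lambda>x. (norm (k x))\<^sup>2)"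
  shows "norm (LINT x|M. f x * k x) \<le> sqrt (LINT x|M. (norm (f x))\<^sup>2) * sqrt (LINT x|M. (norm (k x))\<^sup>2)"
proof -
  let ?F = "LINT x|M. (norm (f x))\<^sup>2" and ?K = "LINT x|M. (norm (k x))\<^sup>2"
  have nn: "0 \<le> ?F" "0 \<le> ?K" by auto
  have "(\<integral>\<^sup>+x. ennreal (norm (f x)) * ennreal (norm (k x)) \<partial>M)\<^sup>2
      \<le> (\<integral>\<^sup>+x. (ennreal (norm (f x)))\<^sup>2 \<partial>M) * (\<integral>\<^sup>+x. (ennreal (norm (k x)))\<^sup>2 \<partial>M)"
    by (rule Cauchy_Schwarz_nn_integral) auto
  also have "\<dots> = ennreal ?F * ennreal ?K"
    using nn_integral_eq_integral[OF f] nn_integral_eq_integral[OF k] by (simp add: ennreal_power)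
  also have "\<dots> = ennreal (?F * ?K)"
    using nn by (simp add: ennreal_mult)
  finally have le: "(\<integral>\<^sup>+x. ennreal (norm (f x * k x)) \<partial>M)\<^sup>2 \<le> ennreal (?F * ?K)"
    by (simp add: norm_mult ennreal_mult)
  have "(\<integral>\<^sup>+x. ennreal (norm (f x * k x)) \<partial>M)\<^sup>2 < top"
    using le by (rule le_less_trans) simp
  then have "(\<integral>\<^sup>+x. ennreal (norm (f x * k x)) \<partial>M) < \<infinity>"
    by (simp add: power_less_top_ennreal)
  then have i: "integrable M (\<lambda>x. f x * k x)"
    by (intro integrableI_bounded) auto
  have "ennreal ((norm (LINT x|M. f x * k x))\<^sup>2) \<le> (\<integral>\<^sup>+x. ennreal (norm (f x * k x)) \<partial>M)\<^sup>2"
    using integral_norm_bound_ennreal[OF i]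
    by (simp add: ennreal_power[symmetric] power_mono)
  from order_trans[OF this le] have "(norm (LINT x|M. f x * k x))\<^sup>2 \<le> ?F * ?K"
    using nn by (subst (asm) ennreal_le_iff) auto
  then have "norm (LINT x|M. f x * k x) \<le> sqrt (?F * ?K)"
    by (simp add: real_le_rsqrt)
  then show ?thesis by (simp add: real_sqrt_mult)
qed

lemma conjugate_pos:
  fixes p q :: real
  assumes "2 \<le> q" "1 / p + 1 / q = 1"
  shows "p > 0"
proof -
  have "1 / q < 1" using assms(1) by simp
  then have "0 < 1 / p" using assms(2) by linarith
  then show ?thesis by simp
qed

text \<open>The pointwise form of Young's convolution inequality for exponents p, p, q/2. It is the
  weighted inequality of arithmetic and geometric means with weights 1/q, 1/q and 1 - 2/q. Each
  product on the right couples only two of the three factors, so its double integral splits.\<close>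

lemma Young_three:
  fixes a b c p q :: real
  assumes "0 \<le> a" "0 \<le> b" "0 \<le> c" and pq: "2 \<le> q" "1 / p + 1 / q = 1"
  shows "a * b * c \<le> 1/q * (a powr p * c powr (q/2)) + 1/q * (b powr p * c powr (q/2))
    + (1 - 2/q) * (a powr p * b powr p)"
proof (cases "a = 0 \<or> b = 0 \<or> c = 0")
  case True
  have "0 \<le> 1 - 2/q" "0 \<le> 1/q" using pq by (auto simp: field_simps)
  moreover have "a * b * c = 0" using True by auto
  ultimately show ?thesis by (metis add_nonneg_nonneg mult_nonneg_nonneg powr_ge_zero)
next
  case False
  then have pos: "a > 0" "b > 0" "c > 0" using assms by auto
  define X Y Z where "X = a powr p * c powr (q/2)" and "Y = b powr p * c powr (q/2)" and "Z = a powr p * b powr p"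
  have XYZ: "X > 0" "Y > 0" "Z > 0" using pos by (auto simp: X_def Y_def Z_def)
  \<comment> \<open>The three-term mean is reached by two two-term ones: \<open>W\<close> is the
    geometric mean of \<open>X\<close> and \<open>Y\<close>, then weights 2/q and 1 - 2/q combine it
    with \<open>Z\<close>.\<close>
  define W where "W = X powr (1/2) * Y powr (1/2)"
  have W: "W > 0" "W \<le> 1/2 * X + 1/2 * Y"
    using XYZ Youngs_inequality_0[of "1/2" "1/2" X Y] by (auto simp: W_def)
  have "W powr (2/q) * Z powr (1 - 2/q) \<le> 2/q * W + (1 - 2/q) * Z"
    by (rule Youngs_inequality_0) (use pq W XYZ in \<open>auto simp: field_simps\<close>)
  also have "\<dots> \<le> 2/q * (1/2 * X + 1/2 * Y) + (1 - 2/q) * Z"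
    using W pq by (intro add_right_mono mult_left_mono) auto
  also have "\<dots> = 1/q * X + 1/q * Y + (1 - 2/q) * Z"
    using pq by (simp add: field_simps)
  also have "W powr (2/q) * Z powr (1 - 2/q) = a * b * c"
  proof -
    have p: "p * (1 - 1/q) = 1" "p \<noteq> 0"
      using pq by (cases "p = 0"; auto simp: field_simps)+
    \<comment> \<open>The exponent with which \<open>a\<close>, and likewise \<open>b\<close>,
      enters the product; that of \<open>c\<close> is \<open>(q/2) * (2/q) = 1\<close>.\<close>
    have e: "p / q + p * (1 - 2/q) = 1"
      using p by (simp add: algebra_simps add_divide_distrib)
    have "ln (W powr (2/q) * Z powr (1 - 2/q))
        = (p / q + p * (1 - 2/q)) * (ln a + ln b) + ln c"
      using pos W XYZ pq unfolding W_def X_def Y_def Z_def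
      by (simp add: ln_mult ln_powr) (simp add: field_simps)
    then have "ln (W powr (2/q) * Z powr (1 - 2/q)) = ln (a * b * c)"
      using pos unfolding e by (simp add: ln_mult)
    then show ?thesis using pos W XYZ by (simp add: ln_inj_iff)
  qed
  finally show ?thesis by (simp add: X_def Y_def Z_def)
qed

lemma nn_integral_lborel_shift:
  fixes f :: "'a::euclidean_space \<Rightarrow> ennreal"
  assumes [measurable]: "f \<in> borel_measurable borel"
  shows "(\<integral>\<^sup>+x. f (x - c) \<partial>lborel) = (\<integral>\<^sup>+x. f x \<partial>lborel)"
proof -
  have "(\<integral>\<^sup>+x. f x \<partial>lborel) = (\<integral>\<^sup>+x. f x \<partial>distr lborel borel ((+) (- c)))"
    by (simp only: lborel_distr_plus)
  also have "\<dots> = (\<integral>\<^sup>+x. f (x - c) \<partial>lborel)"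
    by (subst nn_integral_distr) auto
  finally show ?thesis by simp
qed

text \<open>Both sides are squares of norms, so \<open>sqrt K\<close> is the operator constant.
  Integrability of \<open>g\<close> is demanded besides its L^p bound because otherwise
  \<open>fourier lborel g\<close> would be the default value of the integral.\<close>

definition restriction_bound :: "'a::euclidean_space measure \<Rightarrow> real \<Rightarrow> real \<Rightarrow> bool" where
  "restriction_bound M p K \<longleftrightarrow> 0 \<le> K \<and> (\<forall>g. integrable lborel g \<longrightarrow> integrable lborel (\<lambda>x. norm (g x) powr p) \<longrightarrow>
     (LINT \<xi>|M. (norm (fourier lborel g \<xi>))\<^sup>2) \<le> K * (LINT x|lborel. norm (g x) powr p) powr (2/p))"

context finite_borel_measure
begin

text \<open>The transform is bounded by the integral of |g|. For non-integrable \<open>g\<close>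
  this bound also holds, both integrals then having the default value 0.\<close>

lemma integrable_fourier_square:
  assumes [measurable]: "g \<in> borel_measurable borel"
  shows "integrable M (\<lambda>\<xi>. (norm (fourier lborel g \<xi>))\<^sup>2)"
  by (rule integrable_bounded[of _ "(LINT x|lborel. norm (g x))\<^sup>2"])
     (use norm_fourier_le[of lborel g] in \<open>auto intro: power_mono\<close>)

text \<open>With the integral of |g|^p equal to 1, the three terms of \<open>Young_three\<close>
  integrate to H, H and 1, where H is the integral of |h|^(q/2); the weights 1/q, 1/q and 1 - 2/q
  then give the constant.\<close>

lemma fourier_square_le_normalized:
  fixes p q :: real
  assumes pq: "2 \<le> q" "1 / p + 1 / q = 1"
    and h: "integrable lborel (\<lambda>x. norm (fourier M (\<lambda>_. 1) x) powr (q/2))"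
    and g: "integrable lborel g" and gp: "integrable lborel (\<lambda>x. norm (g x) powr p)"
    and g1: "(LINT x|lborel. norm (g x) powr p) = 1"
  shows "(LINT \<xi>|M. (norm (fourier lborel g \<xi>))\<^sup>2)
    \<le> 2/q * (LINT x|lborel. norm (fourier M (\<lambda>_. 1) x) powr (q/2)) + (1 - 2/q)"
proof -
  have [measurable]: "g \<in> borel_measurable borel"
    using g by auto
  define u where "u x = norm (g x) powr p" for x
  define k where "k x = norm (fourier M (\<lambda>_. 1) x) powr (q/2)" for x
  have [measurable]: "u \<in> borel_measurable borel" "k \<in> borel_measurable borel"
    unfolding u_def k_def by measurable
  define H where "H = (LINT x|lborel. k x)"
  have nn: "0 \<le> u x" "0 \<le> k x" "0 \<le> H" "0 \<le> 1 - 2/q" "0 \<le> 1/q" for x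
    using pq by (auto simp: u_def k_def H_def field_simps)
  have U: "(\<integral>\<^sup>+x. ennreal (u x) \<partial>lborel) = 1"
    using nn_integral_eq_integral[OF gp] g1 by (simp add: u_def)
  have K: "(\<integral>\<^sup>+x. ennreal (k x) \<partial>lborel) = ennreal H"
    using nn_integral_eq_integral[OF h] by (simp add: k_def H_def)
  \<comment> \<open>Translation invariance handles integration in \<open>x\<close>; integration in
    \<open>y\<close> needs the reflected kernel.\<close>
  have keven: "k (x - y) = k (y - x)" for x y
    using norm_transform_one_minus[of "y - x"] by (simp add: k_def)
  have Ky: "(\<integral>\<^sup>+x. ennreal (k (x - y)) \<partial>lborel) = ennreal H" for y
    using nn_integral_lborel_shift[of "\<lambda>x. ennreal (k x)" y] K by simp
  have Kx: "(\<integral>\<^sup>+y. ennreal (k (x - y)) \<partial>lborel) = ennreal H" for x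
    using Ky[of x] keven by (subst nn_integral_cong[where v="\<lambda>y. ennreal (k (y - x))"]) auto
  have 1: "(\<integral>\<^sup>+x. \<integral>\<^sup>+y. ennreal (u x) * ennreal (k (x - y)) \<partial>lborel \<partial>lborel) = ennreal H"
    by (simp add: nn_integral_cmult Kx nn_integral_multc U)
  \<comment> \<open>Here \<open>u\<close> depends on the inner variable, so the order is exchanged
    to integrate the kernel first.\<close>
  have 2: "(\<integral>\<^sup>+x. \<integral>\<^sup>+y. ennreal (u y) * ennreal (k (x - y)) \<partial>lborel \<partial>lborel) = ennreal H"
    by (subst lborel_pair.Fubini') (simp_all add: nn_integral_cmult Ky nn_integral_multc U)
  have 3: "(\<integral>\<^sup>+x. \<integral>\<^sup>+y. ennreal (u x) * ennreal (u y) \<partial>lborel \<partial>lborel) = 1"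
    by (simp add: nn_integral_cmult U nn_integral_multc)
  let ?L = "LINT \<xi>|M. (norm (fourier lborel g \<xi>))\<^sup>2"
  have "ennreal ?L = (\<integral>\<^sup>+\<xi>. ennreal ((norm (fourier lborel g \<xi>))\<^sup>2) \<partial>M)"
    by (subst nn_integral_eq_integral[OF integrable_fourier_square]) auto
  also have "\<dots> \<le> (\<integral>\<^sup>+x. \<integral>\<^sup>+y. ennreal (norm (g x) * norm (g y) * norm (fourier M (\<lambda>_. 1) (x - y))) \<partial>lborel \<partial>lborel)"
    by (rule fourier_square_le[OF g])
  also have "\<dots> \<le> (\<integral>\<^sup>+x. \<integral>\<^sup>+y. ennreal (1/q) * (ennreal (u x) * ennreal (k (x - y)))
      + ennreal (1/q) * (ennreal (u y) * ennreal (k (x - y))) + ennreal (1 - 2/q) * (ennreal (u x) * ennreal (u y)) \<partial>lborel \<partial>lborel)"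
  proof (intro nn_integral_mono)
    fix x y :: 'a
    have "norm (g x) * norm (g y) * norm (fourier M (\<lambda>_. 1) (x - y))
       \<le> 1/q * (u x * k (x - y)) + 1/q * (u y * k (x - y)) + (1 - 2/q) * (u x * u y)"
      unfolding u_def k_def by (rule Young_three) (use pq in auto)
    then have "ennreal (norm (g x) * norm (g y) * norm (fourier M (\<lambda>_. 1) (x - y)))
       \<le> ennreal (1/q * (u x * k (x - y)) + 1/q * (u y * k (x - y)) + (1 - 2/q) * (u x * u y))"
      by (rule ennreal_leI)
    also have "\<dots> = ennreal (1/q) * (ennreal (u x) * ennreal (k (x - y)))
      + ennreal (1/q) * (ennreal (u y) * ennreal (k (x - y))) + ennreal (1 - 2/q) * (ennreal (u x) * ennreal (u y))"
    proof -
      have e: "ennreal (A * B) = ennreal A * ennreal B" if "0 \<le> A" "0 \<le> B" for A B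
        using that by (rule ennreal_mult)
      show ?thesis
        using nn by (simp only: ennreal_plus mult_nonneg_nonneg add_nonneg_nonneg e)
    qed
    finally show "ennreal (norm (g x) * norm (g y) * norm (fourier M (\<lambda>_. 1) (x - y))) \<le> \<dots>" .
  qed
  also have "\<dots> = ennreal (1/q) * ennreal H + ennreal (1/q) * ennreal H + ennreal (1 - 2/q) * 1"
    by (simp add: nn_integral_add nn_integral_cmult nn_integral_multc Kx U 2 del: ennreal_minus)
  also have "\<dots> = ennreal (2/q * H + (1 - 2/q))"
    using nn by (simp flip: ennreal_mult ennreal_plus ennreal_1)
  finally show ?thesis
    using nn unfolding H_def k_def by (subst (asm) ennreal_le_iff) auto
qed

text \<open>Both sides are homogeneous of degree two in \<open>g\<close>, so dividing
  \<open>g\<close> by its L^p norm \<open>c\<close> reduces the claim to the normalized case. If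
  that norm is 0, then \<open>g\<close> vanishes almost everywhere and so does its
  transform.\<close>

lemma restriction_bound_of_transform:
  fixes p q :: real
  assumes pq: "2 \<le> q" "1 / p + 1 / q = 1"
    and h: "integrable lborel (\<lambda>x. norm (fourier M (\<lambda>_. 1) x) powr (q/2))"
  shows "\<exists>K. restriction_bound M p K"
proof -
  define K where "K = 2/q * (LINT x|lborel. norm (fourier M (\<lambda>_. 1) x) powr (q/2)) + (1 - 2/q)"
  have K: "0 \<le> K" unfolding K_def using pq by (intro add_nonneg_nonneg mult_nonneg_nonneg) auto
  have p: "p > 0" by (rule conjugate_pos[OF pq])
  have "(LINT \<xi>|M. (norm (fourier lborel g \<xi>))\<^sup>2) \<le> K * (LINT x|lborel. norm (g x) powr p) powr (2/p)"
    if g: "integrable lborel g" and gp: "integrable lborel (\<lambda>x. norm (g x) powr p)" for g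
  proof -
    define N where "N = (LINT x|lborel. norm (g x) powr p)"
    have [measurable]: "g \<in> borel_measurable borel" using g by auto
    have "0 \<le> N" unfolding N_def by auto
    show ?thesis
    proof (cases "N = 0")
      case True
      then have "AE x in lborel. g x = 0"
        unfolding N_def using integral_nonneg_eq_0_iff_AE[OF gp] by auto
      then have "AE x in lborel. wave (\<xi> \<bullet> x) * g x = 0" for \<xi>
        by auto
      then have "fourier lborel g \<xi> = 0" for \<xi>
        unfolding fourier_eq by (rule integral_eq_zero_AE)
      then show ?thesis using K by simp
    next
      case False
      then have N: "N > 0" using \<open>0 \<le> N\<close> by simp
      define c where "c = N powr (1/p)"
      have c: "c > 0" "c powr p = N" using N p by (auto simp: c_def powr_powr)
      let ?g = "\<lambda>x. g x / of_real c"
      have e: "norm (?g x) powr p = norm (g x) powr p / N" for x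
        using c by (simp add: norm_divide powr_divide)
      have "(LINT \<xi>|M. (norm (fourier lborel ?g \<xi>))\<^sup>2) \<le> K"
        unfolding K_def
      proof (rule fourier_square_le_normalized[OF pq h])
        show "(LINT x|lborel. norm (?g x) powr p) = 1"
          unfolding e using N by (simp add: N_def)
        show "integrable lborel (\<lambda>x. norm (?g x) powr p)"
          unfolding e using gp by simp
      qed (use g in simp)
      moreover have "fourier lborel ?g \<xi> = fourier lborel g \<xi> / of_real c" for \<xi>
        by (simp add: fourier_eq)
      ultimately have "(LINT \<xi>|M. (norm (fourier lborel g \<xi>))\<^sup>2) / c\<^sup>2 \<le> K"
        using c by (simp add: norm_divide power_divide)
      moreover have "c\<^sup>2 = N powr (2/p)"
        using N by (simp add: c_def powr_power)
      ultimately show ?thesis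
        using N by (simp add: N_def[symmetric] field_simps)
    qed
  qed
  then show ?thesis using K by (auto simp: restriction_bound_def)
qed

text \<open>The endpoint p = 1 has an infinite conjugate exponent, outside the reach of the
  convolution argument; there the supremum of the transform and the total mass suffice.\<close>

lemma restriction_bound_one: "restriction_bound M 1 (measure M (space M))"
proof -
  have "(LINT \<xi>|M. (norm (fourier lborel g \<xi>))\<^sup>2) \<le> measure M (space M) * (LINT x|lborel. norm (g x) powr 1) powr 2"
    if g: "integrable lborel g" for g
  proof -
    have "(LINT \<xi>|M. (norm (fourier lborel g \<xi>))\<^sup>2) \<le> (LINT \<xi>|M. (LINT x|lborel. norm (g x))\<^sup>2)"
      using g by (intro integral_mono integrable_fourier_square power_mono norm_fourier_le) auto
    then show ?thesis
      by (simp add: powr_numeral)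
  qed
  then show ?thesis by (auto simp: restriction_bound_def)
qed

section \<open>The extension estimate by duality\<close>

text \<open>The transform is tested against its own dual extremal function, cut off to a ball. The
  cutoff makes the test function integrable and the quantity to be estimated finite, so that a power
  of it may be cancelled; the resulting bound does not depend on the radius.\<close>

lemma extension_estimate:
  fixes p q K :: real
  assumes pq: "2 \<le> q" "1 / p + 1 / q = 1" and K: "restriction_bound M p K"
    and f [measurable]: "f \<in> borel_measurable M" and f2: "integrable M (\<lambda>x. (norm (f x))\<^sup>2)"
  shows "integrable lborel (\<lambda>x. norm (fourier M f x) powr q)"
    and "(LINT x|lborel. norm (fourier M f x) powr q) powr (1/q) \<le> sqrt K * sqrt (LINT x|M. (norm (f x))\<^sup>2)"
proof -
  let ?F = "fourier M f"
  let ?L = "sqrt K * sqrt (LINT x|M. (norm (f x))\<^sup>2)"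
  have K0: "K \<ge> 0" using K by (simp add: restriction_bound_def)
  have L0: "?L \<ge> 0" using K0 by simp
  have p: "p > 0" by (rule conjugate_pos[OF pq])
  \<comment> \<open>This identity turns |g|^p into |F|^q for the test function chosen below.\<close>
  have qp: "(q - 1) * p = q"
  proof -
    have "p * q * (1 / p + 1 / q) = q + p" using p pq(1) by (simp add: distrib_left)
    then show ?thesis using pq(2) by (simp add: algebra_simps)
  qed
  \<comment> \<open>On a finite measure space L^2 is contained in L^1.\<close>
  have fi: "integrable M f"
    using square_integrable_imp_integrable[of "\<lambda>x. norm (f x)"] f2 by (simp add: integrable_norm_iff)
  define B where "B = (LINT x|M. norm (f x))"
  have FB: "norm (?F x) \<le> B" for x unfolding B_def by (rule norm_fourier_le)
  have F [measurable]: "?F \<in> borel_measurable borel" by measurable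
  have bound: "(\<integral>\<^sup>+x. ennreal (norm (?F x) powr q) * indicator (cball 0 R) x \<partial>lborel) \<le> ennreal (?L powr q)" for R
  proof -
    \<comment> \<open>The case of equality in Hoelder's inequality: \<open>?F x * g x\<close> is
      |F|^q and |g|^p is |F|^q, both on the ball.\<close>
    define g where "g x = cnj (?F x) * of_real (norm (?F x) powr (q - 2)) * indicator (cball 0 R) x" for x
    define A where "A = (LINT x|lborel. norm (?F x) powr q * indicator (cball 0 R) x)"
    have [measurable]: "cball (0::'a) R \<in> sets borel" by simp
    have [measurable]: "g \<in> borel_measurable borel" unfolding g_def by measurable
    have ball: "integrable lborel (indicator (cball 0 R :: 'a set) :: 'a \<Rightarrow> real)"
      using emeasure_bounded_finite[of "cball (0::'a) R"] by (simp add: integrable_indicator_iff)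
    have bi: "integrable lborel (\<lambda>x. norm (?F x) powr a * indicator (cball 0 R) x)" if "a \<ge> 0" for a
    proof (rule Bochner_Integration.integrable_bound[OF integrable_mult_right[OF ball, of "B powr a"]])
      have "norm (?F x) powr a \<le> B powr a" for x
        using that FB by (intro powr_mono2) auto
      then show "AE x in lborel. norm (norm (?F x) powr a * indicator (cball 0 R) x)
          \<le> norm (B powr a * indicator (cball 0 R) x)"
        by (intro always_eventually allI) (simp add: indicator_def)
    qed measurable
    have ng: "norm (g x) = norm (?F x) powr (q - 1) * indicator (cball 0 R) x" for x
    proof (cases "?F x = 0")
      case False
      then have "norm (?F x) * norm (?F x) powr (q - 2) = norm (?F x) powr (q - 1)"
        using powr_add[of "norm (?F x)" 1 "q - 2"] by simp
      then show ?thesis by (simp add: g_def norm_mult indicator_def)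
    qed (simp add: g_def)
    have ngp: "norm (g x) powr p = norm (?F x) powr q * indicator (cball 0 R) x" for x
      using qp p by (simp add: ng powr_powr indicator_def)
    have Fg: "?F x * g x = of_real (norm (?F x) powr q * indicator (cball 0 R) x)" for x
    proof (cases "?F x = 0")
      case False
      have "?F x * cnj (?F x) = of_real (norm (?F x) powr 2)"
        using complex_norm_square[of "?F x"] by (simp add: powr_numeral)
      then have "?F x * g x = of_real (norm (?F x) powr 2 * norm (?F x) powr (q - 2)) * indicator (cball 0 R) x"
        by (simp add: g_def)
      also have "norm (?F x) powr 2 * norm (?F x) powr (q - 2) = norm (?F x) powr q"
        unfolding powr_add[symmetric] by simp
      finally show ?thesis by (simp add: indicator_def)
    qed (simp add: g_def)
    have g: "integrable lborel g"
    proof (rule integrable_norm_cancel)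
      show "integrable lborel (\<lambda>x. norm (g x))"
        unfolding ng using pq by (intro bi) simp
    qed measurable
    have gp: "integrable lborel (\<lambda>x. norm (g x) powr p)"
      using bi[of q] pq by (simp add: ngp)
    have A0: "A \<ge> 0" unfolding A_def by auto
    have "of_real A = (LINT x|lborel. ?F x * g x)"
      unfolding Fg A_def by (rule integral_complex_of_real[symmetric])
    also have "\<dots> = (LINT \<xi>|M. f \<xi> * fourier lborel g \<xi>)"
      by (rule fourier_duality[OF fi g])
    finally have eq: "complex_of_real A = (LINT \<xi>|M. f \<xi> * fourier lborel g \<xi>)" .
    have "A = norm (LINT \<xi>|M. f \<xi> * fourier lborel g \<xi>)"
      unfolding eq[symmetric] using A0 by simp
    also have "\<dots> \<le> sqrt (LINT x|M. (norm (f x))\<^sup>2) * sqrt (LINT \<xi>|M. (norm (fourier lborel g \<xi>))\<^sup>2)"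
      by (rule Cauchy_Schwarz_integral_norm) (use f2 in \<open>auto intro: integrable_fourier_square\<close>)
    also have "\<dots> \<le> sqrt (LINT x|M. (norm (f x))\<^sup>2) * sqrt (K * A powr (2/p))"
      using K g gp by (intro mult_left_mono real_sqrt_le_mono) (auto simp: restriction_bound_def ngp A_def)
    also have "sqrt (K * A powr (2/p)) = sqrt K * A powr (1/p)"
    proof -
      have "sqrt (A powr (2/p)) = A powr (1/p)"
        by (rule real_sqrt_unique) (unfold power2_eq_square powr_add[symmetric], simp_all)
      then show ?thesis by (simp add: real_sqrt_mult)
    qed
    finally have le: "A \<le> ?L * A powr (1/p)" by (simp add: ac_simps)
    \<comment> \<open>Since \<open>A\<close> is finite, dividing \<open>le\<close> by
      \<open>A powr (1/p)\<close> leaves \<open>A powr (1/q)\<close>; only A = 0 has to be set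
      aside.\<close>
    have "A \<le> ?L powr q"
    proof (cases "A = 0")
      case False
      then have A: "A > 0" using A0 by simp
      have "A powr (1/q) * A powr (1/p) = A"
        using pq A by (simp add: powr_add[symmetric] add.commute)
      then have "A powr (1/q) \<le> ?L"
        using le A by (intro mult_right_le_imp_le[of "A powr (1/q)" "A powr (1/p)"]) auto
      then have "(A powr (1/q)) powr q \<le> ?L powr q"
        using pq by (intro powr_mono2) auto
      then show ?thesis using A pq by (simp add: powr_powr)
    qed simp
    moreover have "(\<integral>\<^sup>+x. ennreal (norm (?F x) powr q) * indicator (cball 0 R) x \<partial>lborel) = ennreal A"
      unfolding A_def using bi[of q] pq
      by (subst nn_integral_eq_integral[symmetric]) (auto simp: ennreal_mult' ennreal_indicator)
    ultimately show ?thesis by (simp add: ennreal_leI)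
  qed
  \<comment> \<open>Letting the radius grow is monotone convergence, phrased as continuity from
    below of the measure with density |F|^q.\<close>
  let ?D = "density lborel (\<lambda>x. ennreal (norm (?F x) powr q))"
  have "emeasure ?D (\<Union>n::nat. cball 0 (real n)) = (SUP n::nat. emeasure ?D (cball 0 (real n)))"
    by (rule SUP_emeasure_incseq[symmetric]) (auto simp: incseq_def)
  also have "\<dots> \<le> ennreal (?L powr q)"
    by (intro SUP_least) (simp add: emeasure_density bound)
  also have "(\<Union>n::nat. cball 0 (real n)) = (UNIV :: 'a set)"
    by (auto simp: real_arch_simple)
  finally have le: "(\<integral>\<^sup>+x. ennreal (norm (?F x) powr q) \<partial>lborel) \<le> ennreal (?L powr q)"
    by (simp add: emeasure_density)
  show i: "integrable lborel (\<lambda>x. norm (?F x) powr q)"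
    by (rule integrableI_bounded) (use le in \<open>auto intro: le_less_trans\<close>)
  have "(LINT x|lborel. norm (?F x) powr q) \<le> ?L powr q"
    using le nn_integral_eq_integral[OF i] by simp
  then have "(LINT x|lborel. norm (?F x) powr q) powr (1/q) \<le> (?L powr q) powr (1/q)"
    using pq by (intro powr_mono2) auto
  also have "\<dots> = ?L" using L0 pq by (simp add: powr_powr)
  finally show "(LINT x|lborel. norm (?F x) powr q) powr (1/q) \<le> ?L" .
qed

end

section \<open>Schwartz functions\<close>

text \<open>The differentiability half of \<open>schwartz\<close>, which is what linearity of
  \<open>iterated_derivative\<close> rests on: \<open>frechet_derivative\<close> is unspecified at
  points of non-differentiability.\<close>

definition smooth :: "('a::euclidean_space \<Rightarrow> complex) \<Rightarrow> bool" where
  "smooth f \<longleftrightarrow> (\<forall>bs. set bs \<subseteq> Basis \<longrightarrow> (\<forall>x. iterated_derivative bs f differentiable at x))"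

lemma iterated_derivative_lincomb:
  assumes "smooth f" "smooth g" "set bs \<subseteq> Basis"
  shows "iterated_derivative bs (\<lambda>x. a * f x + b * g x)
    = (\<lambda>x. a * iterated_derivative bs f x + b * iterated_derivative bs g x)"
  using assms(3)
proof (induction bs)
  case (Cons v bs)
  have "frechet_derivative (\<lambda>x. a * iterated_derivative bs f x + b * iterated_derivative bs g x) (at x) v
    = a * frechet_derivative (iterated_derivative bs f) (at x) v + b * frechet_derivative (iterated_derivative bs g) (at x) v" for x
  proof -
    have "iterated_derivative bs f differentiable at x" "iterated_derivative bs g differentiable at x"
      using assms Cons.prems by (auto simp: smooth_def)
    then have d: "((\<lambda>x. a * iterated_derivative bs f x + b * iterated_derivative bs g x) has_derivative
      (\<lambda>h. a * frechet_derivative (iterated_derivative bs f) (at x) h + b * frechet_derivative (iterated_derivative bs g) (at x) h)) (at x)"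
      unfolding frechet_derivative_works by (intro has_derivative_add has_derivative_mult_right)
    show ?thesis by (rule fun_cong[OF frechet_derivative_at[OF d, symmetric]])
  qed
  then show ?case using Cons by auto
qed simp

lemma schwartz_smooth: "schwartz f \<Longrightarrow> smooth f"
  by (auto simp: schwartz_def smooth_def)

lemma schwartz_lincomb:
  assumes f: "schwartz f" and g: "schwartz g"
  shows "schwartz (\<lambda>x. a * f x + b * g x)"
  unfolding schwartz_def
proof (intro allI impI conjI)
  fix bs :: "'a list" and x :: 'a and N :: nat
  assume bs: "set bs \<subseteq> Basis"
  note eq = iterated_derivative_lincomb[OF schwartz_smooth[OF f] schwartz_smooth[OF g] bs, of a b]
  show "iterated_derivative bs (\<lambda>x. a * f x + b * g x) differentiable at x"
    unfolding eq using f g bs by (intro derivative_intros) (auto simp: schwartz_def)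
  have "bounded (range (\<lambda>x. norm x ^ N *\<^sub>R iterated_derivative bs f x))"
    "bounded (range (\<lambda>x. norm x ^ N *\<^sub>R iterated_derivative bs g x))"
    using f g bs by (auto simp: schwartz_def)
  then obtain A B where AB: "\<And>x. norm (norm x ^ N *\<^sub>R iterated_derivative bs f x) \<le> A"
    "\<And>x. norm (norm x ^ N *\<^sub>R iterated_derivative bs g x) \<le> B"
    unfolding bounded_iff by auto
  have "norm (norm x ^ N *\<^sub>R (a * iterated_derivative bs f x + b * iterated_derivative bs g x)) \<le> norm a * A + norm b * B" for x
  proof -
    have "norm x ^ N *\<^sub>R (a * iterated_derivative bs f x + b * iterated_derivative bs g x)
      = a * (norm x ^ N *\<^sub>R iterated_derivative bs f x) + b * (norm x ^ N *\<^sub>R iterated_derivative bs g x)"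
      by (simp add: scaleR_add_right)
    also have "norm \<dots> \<le> norm (a * (norm x ^ N *\<^sub>R iterated_derivative bs f x)) + norm (b * (norm x ^ N *\<^sub>R iterated_derivative bs g x))"
      by (rule norm_triangle_ineq)
    also have "\<dots> \<le> norm a * A + norm b * B"
      unfolding norm_mult using AB[of x] by (intro add_mono mult_left_mono) auto
    finally show ?thesis .
  qed
  then show "bounded (range (\<lambda>x. norm x ^ N *\<^sub>R iterated_derivative bs (\<lambda>x. a * f x + b * g x) x))"
    unfolding eq bounded_iff by blast
qed

lemma schwartz_zero: "schwartz (\<lambda>x. 0)"
proof -
  have "iterated_derivative bs (\<lambda>x::'a. 0) = (\<lambda>x. 0)" for bs :: "'a list"
    by (induction bs) auto
  then show ?thesis by (simp add: schwartz_def)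
qed

section \<open>Polynomials times exponentials of polynomials\<close>

text \<open>The second property, that directional derivatives are again polynomials, is what allows
  differentiation to be iterated. Induction along the generation of polynomials supplies
  \<open>D\<close> through the sum and product rules.\<close>

lemma real_polynomial_function_has_derivative:
  assumes "real_polynomial_function p"
  obtains D where "\<And>x. (p has_derivative D x) (at x)" "\<And>b. real_polynomial_function (\<lambda>x. D x b)"
proof -
  have "\<exists>D. (\<forall>x. (p has_derivative D x) (at x)) \<and> (\<forall>b. real_polynomial_function (\<lambda>x. D x b))"
    using assms
  proof induction
    case (linear f)
    then show ?case
      by (intro exI[of _ "\<lambda>_. f"]) (auto intro: bounded_linear_imp_has_derivative)
  next
    case (const c)
    show ?case by (intro exI[of _ "\<lambda>_ _. 0"]) auto
  next
    case (add f g)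
    then obtain D E where "\<forall>x. (f has_derivative D x) (at x)" "\<forall>b. real_polynomial_function (\<lambda>x. D x b)"
      "\<forall>x. (g has_derivative E x) (at x)" "\<forall>b. real_polynomial_function (\<lambda>x. E x b)" by blast
    then show ?case
      by (intro exI[of _ "\<lambda>x h. D x h + E x h"]) (auto intro!: derivative_intros)
  next
    case (mult f g)
    then obtain D E where "\<forall>x. (f has_derivative D x) (at x)" "\<forall>b. real_polynomial_function (\<lambda>x. D x b)"
      "\<forall>x. (g has_derivative E x) (at x)" "\<forall>b. real_polynomial_function (\<lambda>x. E x b)" by blast
    with mult.hyps show ?case
      by (intro exI[of _ "\<lambda>x h. f x * E x h + D x h * g x"]) (auto intro!: has_derivative_mult real_polynomial_function.intros(3,4))
  qed
  then show ?thesis using that by blast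
qed

lemma real_polynomial_function_growth:
  assumes "real_polynomial_function p"
  obtains C m where "0 \<le> C" "\<And>x. \<bar>p x\<bar> \<le> C * (1 + norm x) ^ m"
proof -
  have mono: "(1 + norm x) ^ m \<le> (1 + norm x) ^ (m + n)" for m n and x :: 'a
    by (rule power_increasing) auto
  have "\<exists>C m. 0 \<le> C \<and> (\<forall>x. \<bar>p x\<bar> \<le> C * (1 + norm x) ^ m)"
    using assms
  proof induction
    case (linear f)
    then obtain K where K: "0 < K" "\<And>x. norm (f x) \<le> norm x * K"
      using bounded_linear.pos_bounded by blast
    show ?case
    proof (intro exI conjI allI)
      show "\<bar>f x\<bar> \<le> K * (1 + norm x) ^ 1" for x
        using K(1) K(2)[of x] by (simp add: algebra_simps)
    qed (use K in simp)
  next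
    case (const c)
    show ?case by (intro exI[of _ "\<bar>c\<bar>"] exI[of _ 0]) auto
  next
    case (add f g)
    then obtain A m B n where A: "0 \<le> A" "\<And>x. \<bar>f x\<bar> \<le> A * (1 + norm x) ^ m"
      and B: "0 \<le> B" "\<And>x. \<bar>g x\<bar> \<le> B * (1 + norm x) ^ n" by blast
    have "\<bar>f x + g x\<bar> \<le> (A + B) * (1 + norm x) ^ (m + n)" for x
    proof -
      have "\<bar>f x + g x\<bar> \<le> A * (1 + norm x) ^ m + B * (1 + norm x) ^ n"
        using A(2)[of x] B(2)[of x] by linarith
      also have "\<dots> \<le> A * (1 + norm x) ^ (m + n) + B * (1 + norm x) ^ (m + n)"
        using mono[of x m n] mono[of x n m] A B by (intro add_mono mult_left_mono) (auto simp: add.commute)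
      finally show ?thesis by (simp add: distrib_right)
    qed
    then show ?case using A B by (intro exI[of _ "A + B"] exI[of _ "m + n"]) auto
  next
    case (mult f g)
    then obtain A m B n where A: "0 \<le> A" "\<And>x. \<bar>f x\<bar> \<le> A * (1 + norm x) ^ m"
      and B: "0 \<le> B" "\<And>x. \<bar>g x\<bar> \<le> B * (1 + norm x) ^ n" by blast
    have "\<bar>f x * g x\<bar> \<le> (A * B) * (1 + norm x) ^ (m + n)" for x
    proof -
      have "\<bar>f x\<bar> * \<bar>g x\<bar> \<le> (A * (1 + norm x) ^ m) * (B * (1 + norm x) ^ n)"
        using A B by (intro mult_mono) auto
      then show ?thesis by (simp add: abs_mult power_add ac_simps)
    qed
    then show ?case using A B by (intro exI[of _ "A * B"] exI[of _ "m + n"]) auto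
  qed
  then show ?thesis using that by blast
qed

lemma power_le_exp:
  fixes e :: real
  assumes "e > 0"
  obtains C where "C > 0" "\<And>t. 0 \<le> t \<Longrightarrow> (1 + t) ^ k \<le> C * exp (e * t)"
proof
  \<comment> \<open>Chosen so that \<open>1 + t \<le> ?c * (1 + s)\<close> with
    \<open>s = e * t / Suc k\<close>, after which \<open>1 + s \<le> exp s\<close>. Using
    \<open>Suc k\<close> in place of \<open>k\<close> avoids division by zero at k = 0, and the
    extra power of 1 + t is harmless.\<close>
  let ?c = "max 1 (real (Suc k) / e)"
  show "?c ^ Suc k > 0" by (intro zero_less_power) auto
  fix t :: real assume t: "0 \<le> t"
  let ?s = "e * t / real (Suc k)"
  have "t = real (Suc k) / e * ?s" using assms by simp
  also have "\<dots> \<le> ?c * ?s" using assms t by (intro mult_right_mono) auto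
  finally have "1 + t \<le> ?c + ?c * ?s" by (intro add_mono) auto
  also have "\<dots> = ?c * (1 + ?s)" by (simp only: distrib_left mult_1_right)
  also have "\<dots> \<le> ?c * exp ?s" by (intro mult_left_mono exp_ge_add_one_self) auto
  finally have 1: "1 + t \<le> ?c * exp ?s" .
  have "(1 + t) ^ k \<le> (1 + t) ^ Suc k" using t by (intro power_increasing) auto
  also have "\<dots> \<le> (?c * exp ?s) ^ Suc k" using 1 t by (intro power_mono) auto
  also have "\<dots> = ?c ^ Suc k * exp (e * t)"
    unfolding power_mult_distrib exp_of_nat_mult[symmetric] by simp
  finally show "(1 + t) ^ k \<le> ?c ^ Suc k * exp (e * t)" .
qed

text \<open>The derivative of r exp(-Q) in a direction is (r' - r Q') exp(-Q), with primes for the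
  directional derivatives, so the class is stable and induction applies.\<close>

lemma iterated_derivative_polynomial_exp:
  fixes Q :: "'a::euclidean_space \<Rightarrow> real"
  assumes Q: "real_polynomial_function Q" and p: "real_polynomial_function p"
  shows "\<exists>r. real_polynomial_function r \<and>
    iterated_derivative bs (\<lambda>x. complex_of_real (p x * exp (- Q x))) = (\<lambda>x. of_real (r x * exp (- Q x)))"
proof (induction bs)
  case Nil
  then show ?case using p by auto
next
  case (Cons b bs)
  then obtain r where r: "real_polynomial_function r"
    and eq: "iterated_derivative bs (\<lambda>x. complex_of_real (p x * exp (- Q x))) = (\<lambda>x. of_real (r x * exp (- Q x)))"
    by blast
  obtain D where D: "\<And>x. (Q has_derivative D x) (at x)" "\<And>b. real_polynomial_function (\<lambda>x. D x b)"
    using real_polynomial_function_has_derivative[OF Q] by blast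
  obtain E where E: "\<And>x. (r has_derivative E x) (at x)" "\<And>b. real_polynomial_function (\<lambda>x. E x b)"
    using real_polynomial_function_has_derivative[OF r] by blast
  have d: "((\<lambda>x. complex_of_real (r x * exp (- Q x))) has_derivative
      (\<lambda>h. of_real ((E x h - r x * D x h) * exp (- Q x)))) (at x)" for x
    by (rule has_derivative_eq_rhs, rule has_derivative_of_real, rule has_derivative_mult[OF E(1)],
        rule has_derivative_exp, rule has_derivative_minus, rule D(1)) (auto simp: algebra_simps)
  have "iterated_derivative (b # bs) (\<lambda>x. complex_of_real (p x * exp (- Q x)))
      = (\<lambda>x. of_real ((E x b - r x * D x b) * exp (- Q x)))"
    unfolding iterated_derivative.simps eq by (intro ext fun_cong[OF frechet_derivative_at[OF d, symmetric]])
  moreover have "real_polynomial_function (\<lambda>x. E x b - r x * D x b)"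
    by (intro real_polynomial_function_diff real_polynomial_function.intros(4) r D E)
  ultimately show ?case by blast
qed

text \<open>Every derivative is a polynomial times exp(-Q), and exponential decay in |x| beats
  polynomial growth. A linear lower bound on Q is asked for because it can be had with the same
  \<open>e\<close> and \<open>B\<close> for all the bumps used later.\<close>

lemma schwartz_polynomial_exp:
  fixes Q :: "'a::euclidean_space \<Rightarrow> real"
  assumes Q: "real_polynomial_function Q" and p: "real_polynomial_function p"
    and e: "e > 0" and low: "\<And>x. e * norm x - B \<le> Q x"
  shows "schwartz (\<lambda>x. complex_of_real (p x * exp (- Q x)))"
  unfolding schwartz_def
proof (intro allI impI conjI)
  fix bs :: "'a list" and x :: 'a and N :: nat
  obtain r where r: "real_polynomial_function r"
    and eq: "iterated_derivative bs (\<lambda>x. complex_of_real (p x * exp (- Q x))) = (\<lambda>x. of_real (r x * exp (- Q x)))"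
    using iterated_derivative_polynomial_exp[OF Q p, of bs] by (elim exE conjE) (rule that)
  obtain D where D: "\<And>x. (Q has_derivative D x) (at x)"
    by (rule real_polynomial_function_has_derivative[OF Q]) (rule that)
  obtain E where E: "\<And>x. (r has_derivative E x) (at x)"
    by (rule real_polynomial_function_has_derivative[OF r]) (rule that)
  have "(\<lambda>x. complex_of_real (r x * exp (- Q x))) differentiable at x"
    unfolding differentiable_def
    by (rule exI, rule has_derivative_of_real, rule has_derivative_mult[OF E],
        rule has_derivative_exp, rule has_derivative_minus, rule D)
  then show "iterated_derivative bs (\<lambda>x. complex_of_real (p x * exp (- Q x))) differentiable at x"
    unfolding eq .
  obtain C m where C: "0 \<le> C" "\<And>x. \<bar>r x\<bar> \<le> C * (1 + norm x) ^ m"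
    using real_polynomial_function_growth[OF r] by blast
  \<comment> \<open>The power has to absorb the weight |x|^N of the seminorm and the growth of order
    m of \<open>r\<close>.\<close>
  obtain K where K: "K > 0" "\<And>t. 0 \<le> t \<Longrightarrow> (1 + t) ^ (N + m) \<le> K * exp (e * t)"
    using power_le_exp[OF e] by blast
  have "norm (norm x ^ N *\<^sub>R complex_of_real (r x * exp (- Q x))) \<le> C * K * exp B" for x
  proof -
    have "norm (norm x ^ N *\<^sub>R complex_of_real (r x * exp (- Q x))) = norm x ^ N * \<bar>r x\<bar> * exp (- Q x)"
      by (simp add: norm_mult abs_mult)
    also have "\<dots> \<le> (1 + norm x) ^ N * (C * (1 + norm x) ^ m) * exp (B - e * norm x)"
      using C low[of x] by (intro mult_mono power_mono) auto
    also have "\<dots> = C * ((1 + norm x) ^ (N + m) * exp (- (e * norm x))) * exp B"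
      by (simp add: power_add exp_diff exp_minus field_simps)
    also have "\<dots> \<le> C * (K * exp (e * norm x) * exp (- (e * norm x))) * exp B"
      using C K(2)[of "norm x"] by (intro mult_right_mono mult_left_mono) auto
    also have "\<dots> = C * K * exp B"
      by (simp add: exp_minus)
    finally show ?thesis .
  qed
  then show "bounded (range (\<lambda>x. norm x ^ N *\<^sub>R iterated_derivative bs (\<lambda>x. complex_of_real (p x * exp (- Q x))) x))"
    unfolding eq bounded_iff by blast
qed

section \<open>Integrability from polynomial decay\<close>

text \<open>Dyadic decomposition: where 2^k <= 1 + |x| < 2^(k+1) the integrand is at most 2^(-ka),
  and this region lies in a ball of volume a constant times 2^((k+1)d). The series is geometric with
  ratio 2^(d-a) < 1.\<close>

lemma integrable_one_plus_norm_powr: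
  assumes a: "a > real DIM('a)"
  shows "integrable lborel (\<lambda>x::'a::euclidean_space. (1 + norm x) powr (- a))"
proof (rule integrableI_bounded)
  let ?d = "DIM('a)"
  define v where "v = unit_ball_vol (real ?d)"
  define t where "t k = 2 powr (- (real k * a)) * (v * (2 ^ Suc k) ^ ?d)" for k :: nat
  have v: "v \<ge> 0" by (simp add: v_def)
  have teq: "t k = v * 2 ^ ?d * (2 powr (real ?d - a)) ^ k" for k
    by (simp add: t_def power_mult_distrib powr_realpow[symmetric] powr_powr powr_power
        powr_add[symmetric] power_mult[symmetric] algebra_simps)
  have "2 powr (real ?d - a) < 1" using a by (simp add: powr_less_one)
  then have sum: "summable t"
    unfolding teq by (intro summable_mult summable_geometric) simp
  have t0: "0 \<le> t k" for k using v by (simp add: t_def)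
  have "(\<integral>\<^sup>+(x::'a). ennreal (norm ((1 + norm x) powr (- a))) \<partial>lborel)
    \<le> (\<integral>\<^sup>+(x::'a). (\<Sum>k. ennreal (2 powr (- (real k * a))) * indicator (cball 0 (2 ^ Suc k)) x) \<partial>lborel)"
  proof (rule nn_integral_mono)
    fix x :: 'a
    \<comment> \<open>Minimality supplies the lower end of the dyadic shell; n is not 0 because 1 +
      |x| is at least 1, so the shell index is its predecessor.\<close>
    define n where "n = (LEAST n. 1 + norm x < 2 ^ n)"
    have ex: "\<exists>n. 1 + norm x < (2::real) ^ n" using real_arch_pow[of 2] by simp
    have n: "1 + norm x < 2 ^ n" unfolding n_def using ex by (rule LeastI_ex)
    have "n \<noteq> 0" using n by (metis add_increasing2 norm_ge_zero not_less order_refl power_0)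
    then obtain k where k: "n = Suc k" using not0_implies_Suc by blast
    have "\<not> 1 + norm x < 2 ^ k" using not_less_Least[of k "\<lambda>n. 1 + norm x < 2 ^ n"] k n_def by simp
    then have "2 powr real k \<le> 1 + norm x" by (simp add: powr_realpow)
    then have "(1 + norm x) powr (- a) \<le> (2 powr real k) powr (- a)"
      using a by (intro powr_mono2') auto
    then have "(1 + norm x) powr (- a) \<le> 2 powr (- (real k * a))"
      by (simp add: powr_powr)
    moreover have "x \<in> cball 0 (2 ^ Suc k)" using n k by simp
    ultimately have "ennreal (norm ((1 + norm x) powr (- a)))
        \<le> ennreal (2 powr (- (real k * a))) * indicator (cball 0 (2 ^ Suc k)) x"
      by (simp add: ennreal_leI del: power_Suc)
    also have "\<dots> \<le> (\<Sum>k. ennreal (2 powr (- (real k * a))) * indicator (cball 0 (2 ^ Suc k)) x)"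
    proof -
      have "h k \<le> suminf h" for h :: "nat \<Rightarrow> ennreal"
        using sum_le_suminf[of h "{k}"] by simp
      then show ?thesis .
    qed
    finally show "ennreal (norm ((1 + norm x) powr (- a))) \<le> \<dots>" .
  qed
  also have "\<dots> = (\<Sum>k. ennreal (2 powr (- (real k * a))) * emeasure lborel (cball (0::'a) (2 ^ Suc k)))"
  proof -
    have "(\<integral>\<^sup>+x. (\<Sum>k. c k * indicator (B k) x) \<partial>lborel) = (\<Sum>k. c k * emeasure lborel (B k))"
      if "\<And>k. B k \<in> sets lborel" for c :: "nat \<Rightarrow> ennreal" and B :: "nat \<Rightarrow> 'a set"
      using that by (subst nn_integral_suminf) (auto simp: nn_integral_cmult_indicator)
    then show ?thesis by (simp del: power_Suc)
  qed
  also have "\<dots> = (\<Sum>k. ennreal (t k))"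
  proof (rule arg_cong[of _ _ suminf], rule ext)
    fix k :: nat
    have "emeasure lborel (cball (0::'a) (2 ^ Suc k)) = ennreal (v * (2 ^ Suc k) ^ ?d)"
      unfolding v_def by (rule emeasure_cball) simp
    then show "ennreal (2 powr (- (real k * a))) * emeasure lborel (cball (0::'a) (2 ^ Suc k)) = ennreal (t k)"
      using v unfolding t_def by (simp only: ennreal_mult[symmetric] powr_ge_zero mult_nonneg_nonneg zero_le_power zero_le_numeral)
  qed
  also have "\<dots> < \<infinity>"
    using suminf_ennreal_eq[OF t0 summable_sums[OF sum]] by simp
  finally show "(\<integral>\<^sup>+(x::'a). ennreal (norm ((1 + norm x) powr (- a))) \<partial>lborel) < \<infinity>" .
qed measurable

text \<open>The weight |x|^N gives no control near the origin; the seminorm of order zero does, and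
  (1 + t)^N <= 2^N (1 + t^N) merges the two.\<close>

lemma schwartz_decay:
  fixes f :: "'a::euclidean_space \<Rightarrow> complex"
  assumes "schwartz f"
  obtains C where "0 \<le> C" "\<And>x. norm (f x) \<le> C * (1 + norm x) powr (- real N)"
proof -
  have b: "bounded (range (\<lambda>x. norm x ^ n *\<^sub>R f x))" for n
  proof -
    have "set ([]::'a list) \<subseteq> Basis" by simp
    then have "bounded (range (\<lambda>x. norm x ^ n *\<^sub>R iterated_derivative [] f x))"
      using assms unfolding schwartz_def by blast
    then show ?thesis by simp
  qed
  obtain A where A: "\<And>x. norm (f x) \<le> A"
    using b[of 0] unfolding bounded_iff by auto
  obtain B where B: "\<And>x. norm x ^ N * norm (f x) \<le> B"
    using b[of N] unfolding bounded_iff by auto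
  have AB: "0 \<le> A" "0 \<le> B"
    using order_trans[OF norm_ge_zero A[of 0]] order_trans[OF _ B[of 0]] by auto
  show ?thesis
  proof (rule that[of "2 ^ N * (A + B)"])
    show "0 \<le> 2 ^ N * (A + B)" using AB by simp
    fix x :: 'a
    have "(1 + norm x) ^ N * norm (f x) \<le> (2 ^ N * (1 + norm x ^ N)) * norm (f x)"
    proof (rule mult_right_mono)
      have "(1 + norm x) ^ N \<le> (2 * max 1 (norm x)) ^ N" by (intro power_mono) auto
      also have "\<dots> = 2 ^ N * (max 1 (norm x)) ^ N" by (simp add: power_mult_distrib)
      also have "\<dots> \<le> 2 ^ N * (1 + norm x ^ N)" by (intro mult_left_mono) (auto simp: max_def)
      finally show "(1 + norm x) ^ N \<le> 2 ^ N * (1 + norm x ^ N)" .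
    qed simp
    also have "\<dots> = 2 ^ N * (norm (f x) + norm x ^ N * norm (f x))"
      by (simp add: algebra_simps)
    also have "\<dots> \<le> 2 ^ N * (A + B)"
      using A[of x] B[of x] by (intro mult_left_mono add_mono) auto
    finally have le: "(1 + norm x) ^ N * norm (f x) \<le> 2 ^ N * (A + B)" .
    have "1 + norm x > 0" by (simp add: add_pos_nonneg)
    then show "norm (f x) \<le> 2 ^ N * (A + B) * (1 + norm x) powr (- real N)"
      using le by (simp add: powr_minus powr_realpow field_simps)
  qed
qed

lemma schwartz_borel_measurable: "schwartz f \<Longrightarrow> f \<in> borel_measurable borel"
  using differentiable_imp_continuous_on[of f UNIV]
  by (intro borel_measurable_continuous_onI)
     (auto simp: schwartz_def differentiable_on_def dest!: spec[of _ "[]"])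

text \<open>Decay of order d + 1 lies above the integrability threshold d, and raising to a power p
  >= 1 only improves it since 1 + |x| >= 1. A real \<open>w\<close> covers moduli of Schwartz
  functions and the majorant of the bumps alike.\<close>

lemma integrable_powr_of_decay:
  fixes w :: "'a::euclidean_space \<Rightarrow> real"
  assumes [measurable]: "w \<in> borel_measurable borel" and p: "1 \<le> p"
    and w0: "\<And>x. 0 \<le> w x" and w: "\<And>x. w x \<le> C * (1 + norm x) powr (- real (Suc DIM('a)))" and C: "0 \<le> C"
  shows "integrable lborel (\<lambda>x. w x powr p)"
proof (rule Bochner_Integration.integrable_bound)
  show "integrable lborel (\<lambda>x::'a. C powr p * (1 + norm x) powr (- real (Suc DIM('a))))"
    by (intro integrable_mult_right integrable_one_plus_norm_powr) simp
  have "w x powr p \<le> C powr p * (1 + norm x) powr (- real (Suc DIM('a)))" for x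
  proof -
    have "w x powr p \<le> (C * (1 + norm x) powr (- real (Suc DIM('a)))) powr p"
      using w[of x] w0[of x] p by (intro powr_mono2) auto
    also have "\<dots> = C powr p * (1 + norm x) powr (- real (Suc DIM('a)) * p)"
      using C by (simp add: powr_mult powr_powr)
    also have "\<dots> \<le> C powr p * (1 + norm x) powr (- real (Suc DIM('a)))"
    proof (intro mult_left_mono powr_mono)
      show "- real (Suc DIM('a)) * p \<le> - real (Suc DIM('a))"
        using mult_left_mono[OF p, of "real (Suc DIM('a))"] by simp
    qed auto
    finally show ?thesis .
  qed
  then show "AE x in lborel. norm (w x powr p) \<le> norm (C powr p * (1 + norm x) powr (- real (Suc DIM('a))))"
    by (intro always_eventually allI) (simp add: abs_mult)
qed measurable

lemma schwartz_integrable_powr: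
  fixes f :: "'a::euclidean_space \<Rightarrow> complex"
  assumes f: "schwartz f" and p: "1 \<le> p"
  shows "integrable lborel (\<lambda>x. norm (f x) powr p)"
proof -
  have [measurable]: "f \<in> borel_measurable borel" by (rule schwartz_borel_measurable[OF f])
  obtain C where C: "0 \<le> C" "\<And>x. norm (f x) \<le> C * (1 + norm x) powr (- real (Suc DIM('a)))"
    by (rule schwartz_decay[OF f, of "Suc DIM('a)"]) (rule that)
  show ?thesis
    by (rule integrable_powr_of_decay[OF _ p _ C(2) C(1)]) simp_all
qed

lemma schwartz_integrable:
  assumes "schwartz f"
  shows "integrable lborel f"
proof (rule integrable_norm_cancel)
  show "integrable lborel (\<lambda>x. norm (f x))"
    using schwartz_integrable_powr[OF assms, of 1] by simp
  show "f \<in> borel_measurable lborel"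
    using schwartz_borel_measurable[OF assms] by simp
qed

section \<open>Density of Schwartz functions\<close>

lemma norm_add_powr_le:
  assumes p: "1 \<le> (p::real)"
  shows "norm (a + b :: complex) powr p \<le> 2 powr p * (norm a powr p + norm b powr p)"
proof -
  have "norm (a + b) \<le> 2 * max (norm a) (norm b)"
    using norm_triangle_ineq[of a b] by linarith
  then have "norm (a + b) powr p \<le> (2 * max (norm a) (norm b)) powr p"
    using p by (intro powr_mono2) auto
  also have "\<dots> = 2 powr p * max (norm a) (norm b) powr p"
    by (simp add: powr_mult)
  also have "\<dots> \<le> 2 powr p * (norm a powr p + norm b powr p)"
    by (intro mult_left_mono) (auto simp: max_def)
  finally show ?thesis .
qed

lemma norm_diff_powr_le:
  assumes p: "1 \<le> (p::real)"
  shows "norm (a - b :: complex) powr p \<le> 2 powr p * (norm a powr p + norm b powr p)"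
  using norm_add_powr_le[OF p, of a "- b"] by simp

lemma integrable_norm_powr_add:
  fixes f g :: "'a \<Rightarrow> complex"
  assumes p: "1 \<le> p" and [measurable]: "f \<in> borel_measurable M" "g \<in> borel_measurable M"
    and f: "integrable M (\<lambda>x. norm (f x) powr p)" and g: "integrable M (\<lambda>x. norm (g x) powr p)"
  shows "integrable M (\<lambda>x. norm (f x + g x) powr p)"
    and "(LINT x|M. norm (f x + g x) powr p)
      \<le> 2 powr p * ((LINT x|M. norm (f x) powr p) + (LINT x|M. norm (g x) powr p))"
proof -
  have i: "integrable M (\<lambda>x. 2 powr p * (norm (f x) powr p + norm (g x) powr p))"
    using f g by simp
  show *: "integrable M (\<lambda>x. norm (f x + g x) powr p)"
    by (rule Bochner_Integration.integrable_bound[OF i])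
       (auto intro!: order_trans[OF norm_add_powr_le[OF p]])
  have "(LINT x|M. norm (f x + g x) powr p) \<le> (LINT x|M. 2 powr p * (norm (f x) powr p + norm (g x) powr p))"
    using * i by (rule integral_mono) (rule norm_add_powr_le[OF p])
  then show "(LINT x|M. norm (f x + g x) powr p)
      \<le> 2 powr p * ((LINT x|M. norm (f x) powr p) + (LINT x|M. norm (g x) powr p))"
    using f g by simp
qed

lemma integrable_norm_powr_diff:
  fixes f g :: "'a \<Rightarrow> complex"
  assumes p: "1 \<le> p" and [measurable]: "f \<in> borel_measurable M" "g \<in> borel_measurable M"
    and f: "integrable M (\<lambda>x. norm (f x) powr p)" and g: "integrable M (\<lambda>x. norm (g x) powr p)"
  shows "integrable M (\<lambda>x. norm (f x - g x) powr p)"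
    and "(LINT x|M. norm (f x - g x) powr p)
      \<le> 2 powr p * ((LINT x|M. norm (f x) powr p) + (LINT x|M. norm (g x) powr p))"
  using integrable_norm_powr_add[of p f M "\<lambda>x. - g x"] assms by simp_all

text \<open>Distance is measured by integrals of p-th powers, the form in which the quasi-triangle
  inequality is available. Membership of f in L^p is part of the definition: for other f the
  integral of |\<phi> - f|^p would have the default value 0 and every approximation would count as
  good.\<close>

definition schwartz_closure :: "real \<Rightarrow> ('a::euclidean_space \<Rightarrow> complex) set" where
  "schwartz_closure p = {f \<in> borel_measurable borel. integrable lborel (\<lambda>x. norm (f x) powr p) \<and>
     (\<forall>e>0. \<exists>\<phi>. schwartz \<phi> \<and> (LINT x|lborel. norm (\<phi> x - f x) powr p) < e)}"

lemma schwartz_subset_closure: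
  assumes "schwartz f" "1 \<le> p"
  shows "f \<in> schwartz_closure p"
  unfolding schwartz_closure_def
  using assms schwartz_borel_measurable schwartz_integrable_powr by (auto intro!: exI[of _ f])

lemma schwartz_closure_lincomb:
  assumes p: "1 \<le> p" and f: "f \<in> schwartz_closure p" and g: "g \<in> schwartz_closure p"
  shows "(\<lambda>x. a * f x + b * g x) \<in> schwartz_closure p"
proof -
  have [measurable]: "f \<in> borel_measurable borel" "g \<in> borel_measurable borel"
    and fi: "integrable lborel (\<lambda>x. norm (f x) powr p)" and gi: "integrable lborel (\<lambda>x. norm (g x) powr p)"
    using f g by (auto simp: schwartz_closure_def)
  have sc: "integrable lborel (\<lambda>x. norm (c * h x) powr p)"
    "(LINT x|lborel. norm (c * h x) powr p) = norm c powr p * (LINT x|lborel. norm (h x) powr p)"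
    if "integrable lborel (\<lambda>x. norm (h x) powr p)" for c and h :: "'a \<Rightarrow> complex"
    using that by (simp_all add: norm_mult powr_mult)
  have "\<exists>\<phi>. schwartz \<phi> \<and> (LINT x|lborel. norm (\<phi> x - (a * f x + b * g x)) powr p) < e" if e: "e > 0" for e
  proof -
    \<comment> \<open>The summand 1 keeps \<open>A\<close> positive when a = b = 0 and leaves the
      surplus \<open>E\<close> that makes the final inequality strict.\<close>
    define A where "A = 2 powr p * norm a powr p + 2 powr p * norm b powr p + 1"
    have A: "A > 0" unfolding A_def by (intro add_nonneg_pos) auto
    define E where "E = e / A"
    have E: "E > 0" "A * E = e" using A e by (simp_all add: E_def)
    obtain \<phi> where \<phi>: "schwartz \<phi>" "(LINT x|lborel. norm (\<phi> x - f x) powr p) < E"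
      using f E unfolding schwartz_closure_def by (auto dest: spec[of _ E])
    obtain \<psi> where \<psi>: "schwartz \<psi>" "(LINT x|lborel. norm (\<psi> x - g x) powr p) < E"
      using g E unfolding schwartz_closure_def by (auto dest: spec[of _ E])
    have [measurable]: "\<phi> \<in> borel_measurable borel" "\<psi> \<in> borel_measurable borel"
      using \<phi> \<psi> schwartz_borel_measurable by auto
    have i: "integrable lborel (\<lambda>x. norm (\<phi> x - f x) powr p)"
      by (intro integrable_norm_powr_diff p fi schwartz_integrable_powr \<phi>) auto
    have j: "integrable lborel (\<lambda>x. norm (\<psi> x - g x) powr p)"
      by (intro integrable_norm_powr_diff p gi schwartz_integrable_powr \<psi>) auto
    have "(LINT x|lborel. norm ((a * \<phi> x + b * \<psi> x) - (a * f x + b * g x)) powr p)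
       = (LINT x|lborel. norm (a * (\<phi> x - f x) + b * (\<psi> x - g x)) powr p)"
      by (simp add: algebra_simps)
    also have "\<dots> \<le> 2 powr p * (norm a powr p * (LINT x|lborel. norm (\<phi> x - f x) powr p)
        + norm b powr p * (LINT x|lborel. norm (\<psi> x - g x) powr p))"
      using integrable_norm_powr_add(2)[OF p _ _ sc(1)[OF i, of a] sc(1)[OF j, of b]]
      by (simp add: sc(2)[OF i] sc(2)[OF j])
    also have "\<dots> \<le> 2 powr p * (norm a powr p * E + norm b powr p * E)"
      using \<phi> \<psi> by (intro mult_left_mono add_mono) auto
    also have "\<dots> = A * E - E" by (simp add: A_def algebra_simps)
    also have "\<dots> < e" using E by simp
    finally show ?thesis using schwartz_lincomb[OF \<phi>(1) \<psi>(1)] by blast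
  qed
  moreover have "integrable lborel (\<lambda>x. norm (a * f x + b * g x) powr p)"
    by (intro integrable_norm_powr_add p sc fi gi) auto
  ultimately show ?thesis by (auto simp: schwartz_closure_def)
qed

text \<open>Dominated convergence for p-th powers, followed by approximation of one member of the
  sequence. It serves each limit in the chain from bumps to boxes, to Borel sets, to arbitrary
  functions.\<close>

lemma schwartz_closure_dominated:
  fixes f :: "'a::euclidean_space \<Rightarrow> complex"
  assumes p: "1 \<le> p" and s: "\<And>n. s n \<in> schwartz_closure p"
    and f [measurable]: "f \<in> borel_measurable borel"
    and w [measurable]: "w \<in> borel_measurable borel" and wi: "integrable lborel (\<lambda>x. w x powr p)"
    and lim: "AE x in lborel. (\<lambda>n. s n x) \<longlonglongrightarrow> f x"
    and bd: "\<And>n x. norm (s n x) \<le> w x"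
  shows "f \<in> schwartz_closure p"
proof -
  have [measurable]: "s n \<in> borel_measurable borel"
    and si: "integrable lborel (\<lambda>x. norm (s n x) powr p)" for n
    using s by (auto simp: schwartz_closure_def)
  have fw: "AE x in lborel. norm (f x) \<le> w x"
    using lim
  proof eventually_elim
    case (elim x)
    then show ?case by (intro LIMSEQ_le_const2[OF tendsto_norm[OF elim]]) (auto intro: bd)
  qed
  have fi: "integrable lborel (\<lambda>x. norm (f x) powr p)"
    by (rule Bochner_Integration.integrable_bound[OF wi])
       (use fw p in \<open>auto elim!: eventually_mono intro!: powr_mono2\<close>)
  have "(\<lambda>n. LINT x|lborel. norm (s n x - f x) powr p) \<longlonglongrightarrow> (LINT x|(lborel :: 'a measure). 0 :: real)"
  proof (rule integral_dominated_convergence[where w="\<lambda>x. 2 powr p * (w x powr p + w x powr p)"])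
    show "integrable lborel (\<lambda>x. 2 powr p * (w x powr p + w x powr p))"
      using wi by simp
    show "AE x in lborel. (\<lambda>n. norm (s n x - f x) powr p) \<longlonglongrightarrow> 0"
      using lim
    proof eventually_elim
      case (elim x)
      have "(\<lambda>n. norm (s n x - f x)) \<longlonglongrightarrow> 0"
        using tendsto_norm[OF tendsto_diff[OF elim tendsto_const[of "f x"]]] by simp
      from tendsto_zero_powrI[OF this tendsto_const[of p]] show ?case using p by auto
    qed
    show "AE x in lborel. norm (norm (s n x - f x) powr p) \<le> 2 powr p * (w x powr p + w x powr p)" for n
      using fw
    proof eventually_elim
      case (elim x)
      have "norm (s n x - f x) powr p \<le> 2 powr p * (norm (s n x) powr p + norm (f x) powr p)"
        by (rule norm_diff_powr_le[OF p])
      also have "\<dots> \<le> 2 powr p * (w x powr p + w x powr p)"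
        using elim bd[of n x] p by (intro mult_left_mono add_mono powr_mono2) auto
      finally show ?case by simp
    qed
  qed auto
  then have lim0: "(\<lambda>n. LINT x|lborel. norm (s n x - f x) powr p) \<longlonglongrightarrow> 0" by simp
  have "\<exists>\<phi>. schwartz \<phi> \<and> (LINT x|lborel. norm (\<phi> x - f x) powr p) < e" if e: "e > 0" for e
  proof -
    \<comment> \<open>Half of e, divided by the loss in the quasi-triangle inequality.\<close>
    let ?e = "e / (2 * 2 powr p)"
    have e': "?e > 0" using e by simp
    obtain n where n: "(LINT x|lborel. norm (s n x - f x) powr p) < ?e"
      using order_tendstoD(2)[OF lim0 e'] eventually_sequentially by auto
    obtain \<phi> where \<phi>: "schwartz \<phi>" "(LINT x|lborel. norm (\<phi> x - s n x) powr p) < ?e"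
      using s[of n] e' unfolding schwartz_closure_def by blast
    have [measurable]: "\<phi> \<in> borel_measurable borel"
      using \<phi> schwartz_borel_measurable by auto
    have i: "integrable lborel (\<lambda>x. norm (\<phi> x - s n x) powr p)"
      by (intro integrable_norm_powr_diff p si schwartz_integrable_powr \<phi>) auto
    have j: "integrable lborel (\<lambda>x. norm (s n x - f x) powr p)"
      by (intro integrable_norm_powr_diff p si fi) auto
    have "(LINT x|lborel. norm (\<phi> x - f x) powr p)
      \<le> 2 powr p * ((LINT x|lborel. norm (\<phi> x - s n x) powr p) + (LINT x|lborel. norm (s n x - f x) powr p))"
      using integrable_norm_powr_add(2)[OF p _ _ i j] by simp
    also have "\<dots> < 2 powr p * (?e + ?e)"
      using n \<phi> by (intro mult_strict_left_mono add_strict_mono) auto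
    also have "\<dots> = e" by (simp add: field_simps)
    finally show ?thesis using \<phi>(1) by blast
  qed
  then show ?thesis using fi by (auto simp: schwartz_closure_def)
qed

text \<open>As \<open>n\<close> grows, the bumps \<open>exp (- (\<Sum>b. ((x\<^sub>b - c\<^sub>b) / r\<^sub>b)\<^sup>2\<^sup>n))\<close> tend to the indicator of a box
  off its boundary, under a common exponential bound.\<close>

lemma indicator_box_in_schwartz_closure:
  fixes l u :: "'a::euclidean_space"
  assumes p: "1 \<le> p"
  shows "(indicator (box l u) :: 'a \<Rightarrow> complex) \<in> schwartz_closure p"
proof (cases "\<forall>b\<in>Basis. l \<bullet> b < u \<bullet> b")
  case True
  define c where "c b = (l \<bullet> b + u \<bullet> b) / 2" for b
  define r where "r b = (u \<bullet> b - l \<bullet> b) / 2" for b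
  \<comment> \<open>A common bound for the half side lengths, so that dividing by \<open>R\<close>
    underestimates every normalized coordinate.\<close>
  define R where "R = (\<Sum>b\<in>Basis. r b)"
  have r: "r b > 0" if "b \<in> Basis" for b using True that by (simp add: r_def)
  have rR: "r b \<le> R" if "b \<in> Basis" for b
    unfolding R_def using that r by (intro member_le_sum) (auto simp: less_imp_le)
  have R: "R > 0" unfolding R_def by (intro sum_pos r) auto
  define y where "y x b = (x \<bullet> b - c b) / r b" for x b
  \<comment> \<open>The exponent is even, so that the summands are nonnegative, and positive already
    at n = 0, so that the linear lower bound holds for all n.\<close>
  define Q where "Q n x = (\<Sum>b\<in>Basis. (y x b) ^ (2 * Suc n))" for n x
  \<comment> \<open>Per coordinate, the shift of the centre costs \<open>\<bar>c b\<bar> / R\<close>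
    and the inequality \<open>pow\<close> costs 1.\<close>
  define B where "B = (\<Sum>b\<in>Basis. \<bar>c b\<bar> / R + 1)"
  have pow: "\<bar>t\<bar> - 1 \<le> t ^ (2 * Suc n)" for t :: real and n
  proof (cases "\<bar>t\<bar> \<le> 1")
    case False
    then have "\<bar>t\<bar> ^ 1 \<le> \<bar>t\<bar> ^ (2 * Suc n)" by (intro power_increasing) auto
    then show ?thesis by (simp add: power_mult)
  next
    case True
    have "0 \<le> t ^ (2 * Suc n)" by (simp only: power_mult zero_le_power zero_le_power2)
    then show ?thesis using True by linarith
  qed
  have low: "1/R * norm x - B \<le> Q n x" for n and x :: 'a
  proof -
    have "1/R * norm x - B \<le> 1/R * (\<Sum>b\<in>Basis. \<bar>x \<bullet> b\<bar>) - B"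
      using R norm_le_l1[of x] by (intro diff_right_mono mult_left_mono) auto
    also have "\<dots> = (\<Sum>b\<in>Basis. (\<bar>x \<bullet> b\<bar> - \<bar>c b\<bar>) / R - 1)"
      by (simp add: B_def sum_distrib_left sum_subtractf[symmetric] diff_divide_distrib algebra_simps)
    also have "\<dots> \<le> (\<Sum>b\<in>Basis. \<bar>y x b\<bar> - 1)"
    proof (intro sum_mono diff_right_mono)
      fix b :: 'a assume b: "b \<in> Basis"
      have "(\<bar>x \<bullet> b\<bar> - \<bar>c b\<bar>) / R \<le> \<bar>x \<bullet> b - c b\<bar> / R"
        using R by (intro divide_right_mono) auto
      also have "\<dots> \<le> \<bar>x \<bullet> b - c b\<bar> / r b"
        using rR[OF b] r[OF b] by (intro divide_left_mono) auto
      also have "\<dots> = \<bar>y x b\<bar>" using r[OF b] by (simp add: y_def)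
      finally show "(\<bar>x \<bullet> b\<bar> - \<bar>c b\<bar>) / R \<le> \<bar>y x b\<bar>" .
    qed
    also have "\<dots> \<le> Q n x"
      unfolding Q_def by (intro sum_mono pow)
    finally show ?thesis .
  qed
  have polyQ: "real_polynomial_function (Q n)" for n
  proof -
    have "real_polynomial_function (\<lambda>x. y x b)" for b
      unfolding y_def
      by (intro real_polynomial_function_divide real_polynomial_function_diff
          real_polynomial_function.intros(1,2) bounded_linear_inner_left)
    then show ?thesis
      unfolding Q_def by (intro real_polynomial_function_sum real_polynomial_function_power) auto
  qed
  define s where "s n x = complex_of_real (1 * exp (- Q n x))" for n x
  have sw: "schwartz (s n)" for n
    unfolding s_def using R low
    by (intro schwartz_polynomial_exp[where e="1/R" and B=B] polyQ real_polynomial_function.intros(2)) auto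
  define w where "w x = exp (B - 1/R * norm x)" for x :: 'a
  obtain K where K: "K > 0" "\<And>t. 0 \<le> t \<Longrightarrow> (1 + t) ^ Suc DIM('a) \<le> K * exp (1/R * t)"
    using power_le_exp[of "1/R"] R by (metis zero_less_divide_1_iff)
  have wdec: "w x \<le> (exp B * K) * (1 + norm x) powr (- real (Suc DIM('a)))" for x
  proof -
    have pos: "1 + norm x > 0" by (simp add: add_pos_nonneg)
    have "(1 + norm x) ^ Suc DIM('a) * w x \<le> (K * exp (1/R * norm x)) * w x"
      using K(2)[of "norm x"] by (intro mult_right_mono) (auto simp: w_def)
    also have "\<dots> = exp B * K" by (simp add: w_def exp_diff)
    finally have "(1 + norm x) ^ Suc DIM('a) * w x \<le> exp B * K" .
    moreover have "v \<le> C * inverse P" if "P * v \<le> C" "P > 0" for v C P :: real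
      using that by (simp add: field_simps)
    ultimately show ?thesis
      unfolding powr_minus powr_realpow[OF pos] using pos by (simp del: power_Suc)
  qed
  have [measurable]: "w \<in> borel_measurable borel" unfolding w_def by measurable
  show ?thesis
  proof (rule schwartz_closure_dominated[OF p schwartz_subset_closure[OF sw p], where w=w])
    show "integrable lborel (\<lambda>x. w x powr p)"
      by (rule integrable_powr_of_decay[OF _ p _ wdec]) (use K in \<open>auto simp: w_def\<close>)
    show "norm (s n x) \<le> w x" for n x
      using low[of x n] by (simp add: s_def w_def)
    \<comment> \<open>On the faces some normalized coordinate has modulus 1 and the bumps tend to a
      positive number, not to the indicator.\<close>
    have "cbox l u - box l u \<in> null_sets lborel"
    proof -
      have "emeasure lborel (cbox l u - box l u) = emeasure lborel (cbox l u) - emeasure lborel (box l u)"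
        using emeasure_lborel_box_finite[of l u] by (intro emeasure_Diff) (auto simp: box_subset_cbox)
      also have "\<dots> = 0" by (simp add: emeasure_lborel_cbox_eq emeasure_lborel_box_eq)
      finally show ?thesis by auto
    qed
    then have "AE x in lborel. x \<notin> cbox l u - box l u" by (rule AE_not_in)
    then show "AE x in lborel. (\<lambda>n. s n x) \<longlonglongrightarrow> indicator (box l u) x"
    proof eventually_elim
      case (elim x)
      show ?case
      proof (cases "x \<in> box l u")
        case True
        have "(\<lambda>n. (y x b) ^ (2 * Suc n)) \<longlonglongrightarrow> 0" if b: "b \<in> Basis" for b
        proof -
          have "\<bar>y x b\<bar> < 1"
          proof -
            have "l \<bullet> b < x \<bullet> b" "x \<bullet> b < u \<bullet> b" using True b by (auto simp: mem_box)
            then have "\<bar>x \<bullet> b - c b\<bar> < r b" by (auto simp: c_def r_def abs_if field_simps)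
            then show ?thesis using r[OF b] by (simp add: y_def)
          qed
          then have "(y x b)\<^sup>2 < 1" by (simp add: abs_square_less_1)
          then have "(\<lambda>n. ((y x b)\<^sup>2) ^ Suc n) \<longlonglongrightarrow> 0"
            by (intro LIMSEQ_Suc LIMSEQ_realpow_zero) auto
          then show ?thesis by (simp only: power_mult)
        qed
        then have "(\<lambda>n. Q n x) \<longlonglongrightarrow> (\<Sum>b\<in>(Basis::'a set). 0)"
          unfolding Q_def by (rule tendsto_sum)
        then have "(\<lambda>n. s n x) \<longlonglongrightarrow> of_real (1 * exp (- (\<Sum>b\<in>(Basis::'a set). 0)))"
          unfolding s_def by (intro tendsto_intros)
        then show ?thesis using True by simp
      next
        case False
        with elim have "x \<notin> cbox l u" by simp
        then obtain b where b: "b \<in> Basis" "x \<bullet> b < l \<bullet> b \<or> u \<bullet> b < x \<bullet> b"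
          by (auto simp: mem_box not_le)
        then have "\<bar>x \<bullet> b - c b\<bar> > r b" by (auto simp: c_def r_def abs_if field_simps)
        then have "\<bar>y x b\<bar> > 1" using r[OF b(1)] by (simp add: y_def)
        then have y1: "(y x b)\<^sup>2 > 1" using one_less_power[of "\<bar>y x b\<bar>" 2] by simp
        \<comment> \<open>One coordinate beyond its face suffices: its summand bounds
          \<open>Q n x\<close> from below and grows geometrically, and exp Q >= Q.\<close>
        have "norm (s n x) \<le> inverse (((y x b)\<^sup>2) ^ Suc n)" for n
        proof -
          have "((y x b)\<^sup>2) ^ Suc n \<le> Q n x"
            unfolding Q_def power_mult using b(1) by (intro member_le_sum) auto
          also have "\<dots> \<le> exp (Q n x)" using exp_ge_add_one_self[of "Q n x"] by linarith
          finally have "inverse (exp (Q n x)) \<le> inverse (((y x b)\<^sup>2) ^ Suc n)"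
            by (rule le_imp_inverse_le) (rule zero_less_power, use y1 in linarith)
          moreover have "norm (s n x) = exp (- Q n x)" unfolding s_def norm_of_real by simp
          ultimately show ?thesis by (simp only: exp_minus)
        qed
        moreover have "(\<lambda>n. inverse (((y x b)\<^sup>2) ^ Suc n)) \<longlonglongrightarrow> 0"
          using LIMSEQ_inverse_realpow_zero[OF y1] by (rule LIMSEQ_Suc)
        ultimately have "(\<lambda>n. s n x) \<longlonglongrightarrow> 0"
          by (intro Lim_null_comparison[of "\<lambda>n. s n x"]) auto
        then show ?thesis using False by simp
      qed
    qed
  qed auto
next
  case False
  then have e: "box l u = {}" by (force simp: mem_box)
  show ?thesis
    unfolding e using schwartz_subset_closure[OF schwartz_zero p] by (simp add: indicator_def[abs_def])
qed

lemma schwartz_closure_sum: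
  assumes p: "1 \<le> p" and "finite I" "\<And>i. i \<in> I \<Longrightarrow> f i \<in> schwartz_closure p"
  shows "(\<lambda>x. \<Sum>i\<in>I. a i * f i x) \<in> schwartz_closure p"
  using assms(2,3)
proof (induction I)
  case empty
  then show ?case using schwartz_subset_closure[OF schwartz_zero p] by simp
next
  case (insert i I)
  then show ?case
    using schwartz_closure_lincomb[OF p, of "f i" "\<lambda>x. \<Sum>i\<in>I. a i * f i x" "a i" 1] by simp
qed

section \<open>From boxes to Borel sets and to all of L^p\<close>

text \<open>A Dynkin argument over the intersection-stable family of boxes. Cutting with one fixed
  box keeps complements of finite measure and provides the common majorant for disjoint
  unions.\<close>

lemma indicator_Int_box_in_schwartz_closure:
  fixes l u :: "'a::euclidean_space"
  assumes p: "1 \<le> p" and A: "A \<in> sets borel"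
  shows "(indicator (A \<inter> box l u) :: 'a \<Rightarrow> complex) \<in> schwartz_closure p"
proof -
  let ?W = "box l u" and ?G = "range (\<lambda>(a, b). box a b :: 'a set)"
  have "Int_stable ?G" by (auto simp: Int_stable_def box_Int_box)
  moreover have "?G \<subseteq> Pow UNIV" by simp
  moreover have sb: "sigma_sets UNIV ?G = sets borel" by (simp add: borel_eq_box)
  then have "A \<in> sigma_sets UNIV ?G" using A by simp
  ultimately show ?thesis
  proof (induction rule: sigma_sets_induct_disjoint)
    case (basic A)
    then show ?case by (auto simp: box_Int_box intro: indicator_box_in_schwartz_closure[OF p])
  next
    case empty
    then show ?case
      using schwartz_subset_closure[OF schwartz_zero p] by (simp add: indicator_def[abs_def])
  next
    case (compl A)
    have "(indicator ((UNIV - A) \<inter> ?W) :: 'a \<Rightarrow> complex)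
      = (\<lambda>x. 1 * indicator ?W x + (- 1) * indicator (A \<inter> ?W) x)"
      by (auto simp: indicator_def)
    then show ?case
      using schwartz_closure_lincomb[OF p indicator_box_in_schwartz_closure[OF p] compl(2)] by metis
  next
    case (union A)
    have meas: "A i \<in> sets borel" for i using union sb by auto
    show ?case
    proof (rule schwartz_closure_dominated[OF p])
      show "(\<lambda>x. \<Sum>i<n. 1 * indicator (A i \<inter> ?W) x) \<in> schwartz_closure p" for n
        by (intro schwartz_closure_sum[OF p]) (use union in auto)
      \<comment> \<open>Disjointness keeps the partial sums bounded by 1, hence below the indicator
        of the fixed box.\<close>
      have eq: "(\<Sum>i<n. 1 * indicator (A i \<inter> ?W) x) = (indicator (\<Union>i<n. A i \<inter> ?W) x :: complex)" for n x
      proof -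
        have "disjoint_family_on (\<lambda>i. A i \<inter> ?W) {..<n}"
          using union(1) unfolding disjoint_family_on_def by blast
        then show ?thesis
          by (simp only: mult_1_left) (rule indicator_UN_disjoint[symmetric], simp_all)
      qed
      show "norm (\<Sum>i<n. 1 * indicator (A i \<inter> ?W) x :: complex) \<le> indicator ?W x" for n x
        unfolding eq by (auto simp: indicator_def)
      show "AE x in lborel. (\<lambda>n. \<Sum>i<n. 1 * indicator (A i \<inter> ?W) x :: complex) \<longlonglongrightarrow> indicator ((\<Union>i. A i) \<inter> ?W) x"
      proof (intro always_eventually allI)
        fix x
        show "(\<lambda>n. \<Sum>i<n. 1 * indicator (A i \<inter> ?W) x :: complex) \<longlonglongrightarrow> indicator ((\<Union>i. A i) \<inter> ?W) x"
          unfolding eq using LIMSEQ_indicator_UN[of "\<lambda>i. A i \<inter> ?W" x] by simp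
      qed
      have "(\<lambda>x::'a. indicator ?W x powr p) = (indicator ?W :: 'a \<Rightarrow> real)"
        by (auto simp: indicator_def)
      then show "integrable lborel (\<lambda>x::'a. indicator ?W x powr p :: real)"
        using emeasure_lborel_box_finite[of l u] by (simp add: integrable_indicator_iff)
    qed (use meas in measurable)
  qed
qed

text \<open>Simple functions converge to \<open>f\<close> pointwise with modulus at most 2|f|; cut
  off to growing cubes they are finite combinations of the indicators treated above, and 2|f| is the
  majorant.\<close>

theorem schwartz_dense:
  fixes f :: "'a::euclidean_space \<Rightarrow> complex"
  assumes p: "1 \<le> p" and f [measurable]: "f \<in> borel_measurable borel"
    and fi: "integrable lborel (\<lambda>x. norm (f x) powr p)"
  shows "f \<in> schwartz_closure p"
proof -
  obtain F where F: "\<And>i. simple_function borel (F i)" "\<And>x. (\<lambda>i. F i x) \<longlonglongrightarrow> f x"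
    "\<And>i x. norm (F i x) \<le> 2 * norm (f x)"
    using borel_measurable_implies_sequence_metric[OF f, of 0] unfolding dist_0_norm norm_conv_dist by auto
  define W where "W i = box (- (real i *\<^sub>R One)) (real i *\<^sub>R One :: 'a)" for i :: nat
  have 1: "(\<lambda>x. F i x * indicator (W i) x) \<in> schwartz_closure p" for i
  proof -
    have fin: "finite (range (F i))" using F(1)[of i] by (simp add: simple_function_def)
    have "(\<lambda>x. F i x * indicator (W i) x) = (\<lambda>x. \<Sum>v\<in>range (F i). v * indicator ((F i -` {v}) \<inter> W i) x)"
    proof
      fix x
      have "(\<Sum>v\<in>range (F i). v * indicator ((F i -` {v}) \<inter> W i) x)
        = (\<Sum>v\<in>range (F i). if v = F i x then F i x * indicator (W i) x else 0)"
        by (intro sum.cong) (auto simp: indicator_def)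
      then show "F i x * indicator (W i) x = (\<Sum>v\<in>range (F i). v * indicator ((F i -` {v}) \<inter> W i) x)"
        using fin by simp
    qed
    moreover have "(\<lambda>x. \<Sum>v\<in>range (F i). v * indicator ((F i -` {v}) \<inter> W i) x) \<in> schwartz_closure p"
    proof (intro schwartz_closure_sum[OF p fin])
      fix v
      have "F i -` {v} \<in> sets borel"
        using simple_functionD(2)[OF F(1), of i "{v}"] by simp
      then show "indicator (F i -` {v} \<inter> W i) \<in> schwartz_closure p"
        unfolding W_def by (rule indicator_Int_box_in_schwartz_closure[OF p])
    qed
    ultimately show ?thesis by simp
  qed
  show ?thesis
  proof (rule schwartz_closure_dominated[OF p 1 f])
    show "integrable lborel (\<lambda>x. (2 * norm (f x)) powr p)"
      using fi by (simp add: powr_mult)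
    show "norm (F i x * indicator (W i) x) \<le> 2 * norm (f x)" for i x
      using F(3)[of i x] by (auto simp: indicator_def)
    show "AE x in lborel. (\<lambda>i. F i x * indicator (W i) x) \<longlonglongrightarrow> f x"
    proof (intro always_eventually allI)
      fix x :: 'a
      \<comment> \<open>The sum of the moduli of the coordinates bounds each of them, so x lies in
        every cube from index N on, and the cutoff has no effect there.\<close>
      obtain N :: nat where N: "(\<Sum>b\<in>Basis. \<bar>x \<bullet> b\<bar>) < real N" using reals_Archimedean2 by blast
      have "x \<in> W i" if "N \<le> i" for i
      proof -
        have "- real i < x \<bullet> b \<and> x \<bullet> b < real i" if b: "b \<in> Basis" for b
        proof -
          have "\<bar>x \<bullet> b\<bar> \<le> (\<Sum>b\<in>Basis. \<bar>x \<bullet> b\<bar>)" using b by (intro member_le_sum) auto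
          then show ?thesis using N \<open>N \<le> i\<close> by linarith
        qed
        then show ?thesis by (auto simp: W_def mem_box)
      qed
      then have "\<forall>\<^sub>F i in sequentially. F i x = F i x * indicator (W i) x"
        by (auto simp: eventually_sequentially intro!: exI[of _ N])
      then show "(\<lambda>i. F i x * indicator (W i) x) \<longlonglongrightarrow> f x"
        using F(2)[of x] by (rule Lim_transform_eventually[rotated])
    qed
  qed measurable
qed

section \<open>The extension by density\<close>

lemma Lp_ereal_iff:
  "f \<in> Lp M (ereal p) \<longleftrightarrow> f \<in> borel_measurable M \<and> integrable M (\<lambda>x. norm (f x) powr p)"
  by (simp add: Lp_def)

lemma Lp_norm_ereal: "Lp_norm M (ereal p) f = (LINT x|M. norm (f x) powr p) powr (1 / p)"
  by (simp add: Lp_norm_def)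

lemma Lp_two_iff: "f \<in> Lp M 2 \<longleftrightarrow> f \<in> borel_measurable M \<and> integrable M (\<lambda>x. (norm (f x))\<^sup>2)"
  using Lp_ereal_iff[of f M 2] by (simp add: powr_numeral)

lemma Lp_norm_two: "Lp_norm M 2 f = sqrt (LINT x|M. (norm (f x))\<^sup>2)"
  using Lp_norm_ereal[of M 2 f] by (simp add: powr_numeral powr_half_sqrt)

context finite_borel_measure
begin

text \<open>Two approximants are compared through f, at the price of the factor 2^p; linearity on
  integrable functions and the restriction bound for their difference turn L^p closeness into L^2
  closeness of the transforms.\<close>

lemma fourier_schwartz_diff_bound:
  assumes K: "restriction_bound M p K" and p: "1 \<le> p"
    and f [measurable]: "f \<in> borel_measurable borel" and fi: "integrable lborel (\<lambda>x. norm (f x) powr p)"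
    and \<phi>: "schwartz \<phi>" and \<psi>: "schwartz \<psi>"
    and e: "(LINT x|lborel. norm (\<phi> x - f x) powr p) \<le> e" "(LINT x|lborel. norm (\<psi> x - f x) powr p) \<le> e"
  shows "(LINT \<xi>|M. (norm (fourier lborel \<phi> \<xi> - fourier lborel \<psi> \<xi>))\<^sup>2) \<le> K * (2 powr p * (2 * e)) powr (2 / p)"
proof -
  have [measurable]: "\<phi> \<in> borel_measurable borel" "\<psi> \<in> borel_measurable borel"
    using \<phi> \<psi> schwartz_borel_measurable by auto
  have K0: "0 \<le> K" using K by (simp add: restriction_bound_def)
  have \<phi>i: "integrable lborel (\<lambda>x. norm (\<phi> x) powr p)" and \<psi>i: "integrable lborel (\<lambda>x. norm (\<psi> x) powr p)"
    using schwartz_integrable_powr \<phi> \<psi> p by auto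
  have i: "integrable lborel (\<lambda>x. norm (\<phi> x - f x) powr p)"
    by (intro integrable_norm_powr_diff p fi \<phi>i) auto
  have j: "integrable lborel (\<lambda>x. norm (\<psi> x - f x) powr p)"
    by (intro integrable_norm_powr_diff p fi \<psi>i) auto
  have "(LINT x|lborel. norm (\<phi> x - \<psi> x) powr p)
      \<le> 2 powr p * ((LINT x|lborel. norm (\<phi> x - f x) powr p) + (LINT x|lborel. norm (\<psi> x - f x) powr p))"
    using integrable_norm_powr_diff(2)[OF p _ _ i j] by simp
  also have "\<dots> \<le> 2 powr p * (2 * e)"
    using e by (intro mult_left_mono) auto
  finally have N: "(LINT x|lborel. norm (\<phi> x - \<psi> x) powr p) \<le> 2 powr p * (2 * e)" .
  have "(LINT \<xi>|M. (norm (fourier lborel \<phi> \<xi> - fourier lborel \<psi> \<xi>))\<^sup>2)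
      = (LINT \<xi>|M. (norm (fourier lborel (\<lambda>x. \<phi> x - \<psi> x) \<xi>))\<^sup>2)"
    by (simp add: fourier_diff[OF _ schwartz_integrable[OF \<phi>] schwartz_integrable[OF \<psi>]])
  also have "\<dots> \<le> K * (LINT x|lborel. norm (\<phi> x - \<psi> x) powr p) powr (2 / p)"
    using K schwartz_integrable[OF \<phi>] schwartz_integrable[OF \<psi>] integrable_norm_powr_diff(1)[OF p _ _ \<phi>i \<psi>i]
    by (auto simp: restriction_bound_def)
  also have "\<dots> \<le> K * (2 powr p * (2 * e)) powr (2 / p)"
    using N p K0 by (intro mult_left_mono powr_mono2) auto
  finally show ?thesis .
qed

text \<open>A Riesz--Fischer argument without Minkowski: \<open>t \<le> 2\<^sup>-\<^sup>n + 2\<^sup>n t\<^sup>2\<close> bounds the increments by a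
  series that converges almost everywhere, and Fatou's lemma gives the rate.\<close>

lemma L2_limit_of_fast_Cauchy:
  fixes h :: "nat \<Rightarrow> 'a \<Rightarrow> complex"
  assumes [measurable]: "\<And>n. h n \<in> borel_measurable M"
    and hi: "\<And>n. integrable M (\<lambda>x. (norm (h n x))\<^sup>2)"
    and K: "0 \<le> K" and c: "\<And>n m. n \<le> m \<Longrightarrow> (LINT x|M. (norm (h n x - h m x))\<^sup>2) \<le> K * (1/16) ^ n"
  obtains g where "g \<in> borel_measurable M" "integrable M (\<lambda>x. (norm (g x))\<^sup>2)"
    "\<And>n. (LINT x|M. (norm (h n x - g x))\<^sup>2) \<le> K * (1/16) ^ n"
proof -
  have i: "integrable M (\<lambda>x. (norm (h n x - h m x))\<^sup>2)" for n m
    using integrable_norm_powr_diff(1)[of 2 "h n" M "h m"] hi by (simp add: powr_numeral)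
  have c': "(\<integral>\<^sup>+x. ennreal ((norm (h n x - h m x))\<^sup>2) \<partial>M) \<le> ennreal (K * (1/16) ^ n)" if "n \<le> m" for n m
    using c[OF that] nn_integral_eq_integral[OF i[of n m]] by (simp add: ennreal_leI)
  define d where "d n x = h (Suc n) x - h n x" for n x
  \<comment> \<open>The weight 2^n is affordable: against the rate 16^(-n) the integrals of
    \<open>u n\<close> still decay like 8^(-n).\<close>
  define u where "u n x = 2 ^ n * (norm (d n x))\<^sup>2" for n x
  have [measurable]: "d n \<in> borel_measurable M" "u n \<in> borel_measurable M" for n
    unfolding d_def u_def by measurable
  have un: "(\<integral>\<^sup>+x. ennreal (u n x) \<partial>M) \<le> ennreal (K * (1/8) ^ n)" for n
  proof -
    have "(\<integral>\<^sup>+x. ennreal (u n x) \<partial>M) = ennreal (2 ^ n) * (\<integral>\<^sup>+x. ennreal ((norm (h n x - h (Suc n) x))\<^sup>2) \<partial>M)"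
      unfolding u_def d_def by (simp add: ennreal_mult' nn_integral_cmult norm_minus_commute)
    also have "\<dots> \<le> ennreal (2 ^ n) * ennreal (K * (1/16) ^ n)"
      by (intro mult_left_mono c') auto
    also have "\<dots> = ennreal (2 ^ n * (K * (1/16) ^ n))"
      using K by (simp add: ennreal_mult)
    also have "2 ^ n * (K * (1/16) ^ n) = K * (1/8) ^ n"
      using power_mult_distrib[of 2 "1/16::real" n] by simp
    finally show ?thesis .
  qed
  have "(\<integral>\<^sup>+x. (\<Sum>n. ennreal (u n x)) \<partial>M) = (\<Sum>n. \<integral>\<^sup>+x. ennreal (u n x) \<partial>M)"
    by (rule nn_integral_suminf) simp
  also have "\<dots> \<le> (\<Sum>n. ennreal (K * (1/8) ^ n))"
    by (intro suminf_le un) auto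
  also have "\<dots> = ennreal (\<Sum>n. K * (1/8) ^ n)"
    using K by (intro suminf_ennreal2 summable_mult summable_geometric) auto
  finally have fin: "(\<integral>\<^sup>+x. (\<Sum>n. ennreal (u n x)) \<partial>M) \<noteq> \<infinity>"
    by (auto simp: top_unique)
  have "AE x in M. (\<Sum>n. ennreal (u n x)) \<noteq> \<infinity>"
    by (rule nn_integral_noteq_infinite[OF _ fin]) simp
  then have conv: "AE x in M. convergent (\<lambda>n. h n x)"
  proof eventually_elim
    case (elim x)
    have "summable (\<lambda>n. u n x)"
      by (rule summable_suminf_not_top) (use elim in \<open>auto simp: u_def\<close>)
    then have s: "summable (\<lambda>n. (1/2) ^ n + u n x)"
      by (intro summable_add summable_geometric) auto
    have "norm (d n x) \<le> (1/2) ^ n + u n x" for n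
    proof -
      \<comment> \<open>Either t <= 1/a, or a t > 1 and then t < a t^2.\<close>
      have *: "t \<le> inverse a + a * t\<^sup>2" if "a > 0" for t a :: real
      proof (cases "a * t \<le> 1")
        case True
        then have "t \<le> inverse a" using that by (simp add: field_simps)
        then show ?thesis using that by (simp add: add_increasing2)
      next
        case False
        then have "t > 0" using that by (smt (verit) mult_nonneg_nonpos)
        then have "1 * t \<le> (a * t) * t" using False by (intro mult_right_mono) auto
        moreover have "inverse a > 0" using that by simp
        ultimately show ?thesis unfolding power2_eq_square mult.assoc by linarith
      qed
      show ?thesis using *[of "2 ^ n" "norm (d n x)"] by (simp add: u_def power_one_over inverse_eq_divide)
    qed
    then have "summable (\<lambda>n. d n x)"
      by (intro summable_comparison_test'[OF s]) auto
    then have "convergent (\<lambda>n. \<Sum>k<n. d k x)"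
      by (simp add: summable_iff_convergent)
    then have "convergent (\<lambda>n. h n x - h 0 x)"
      unfolding d_def sum_lessThan_telescope[of "\<lambda>k. h k x"] .
    then have "convergent (\<lambda>n. (h n x - h 0 x) + h 0 x)"
      by (intro convergent_add convergent_const)
    then show ?case by simp
  qed
  \<comment> \<open>Where the sequence diverges this value is arbitrary, but that happens only on a
    null set.\<close>
  define g where "g x = lim (\<lambda>n. h n x)" for x
  have g [measurable]: "g \<in> borel_measurable M"
    unfolding g_def by (rule borel_measurable_lim_metric) simp
  have lim: "AE x in M. (\<lambda>m. h m x) \<longlonglongrightarrow> g x"
    using conv by eventually_elim (simp add: g_def convergent_LIMSEQ_iff)
  have fatou: "(\<integral>\<^sup>+x. ennreal ((norm (h n x - g x))\<^sup>2) \<partial>M) \<le> ennreal (K * (1/16) ^ n)" for n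
  proof -
    have "(\<integral>\<^sup>+x. ennreal ((norm (h n x - g x))\<^sup>2) \<partial>M)
      = (\<integral>\<^sup>+x. liminf (\<lambda>m. ennreal ((norm (h n x - h m x))\<^sup>2)) \<partial>M)"
    proof (rule nn_integral_cong_AE)
      show "AE x in M. ennreal ((norm (h n x - g x))\<^sup>2) = liminf (\<lambda>m. ennreal ((norm (h n x - h m x))\<^sup>2))"
        using lim
      proof eventually_elim
        case (elim x)
        have "(\<lambda>m. ennreal ((norm (h n x - h m x))\<^sup>2)) \<longlonglongrightarrow> ennreal ((norm (h n x - g x))\<^sup>2)"
          by (intro tendsto_ennrealI tendsto_intros elim)
        then show ?case by (rule lim_imp_Liminf[OF sequentially_bot, symmetric])
      qed
    qed
    also have "\<dots> \<le> liminf (\<lambda>m. \<integral>\<^sup>+x. ennreal ((norm (h n x - h m x))\<^sup>2) \<partial>M)"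
      by (rule nn_integral_liminf) simp
    also have "\<dots> \<le> liminf (\<lambda>m. ennreal (K * (1/16) ^ n))"
      by (rule Liminf_mono) (auto simp: eventually_sequentially intro!: exI[of _ n] c')
    also have "\<dots> = ennreal (K * (1/16) ^ n)"
      by (simp add: Liminf_const)
    finally show ?thesis .
  qed
  have hg: "integrable M (\<lambda>x. (norm (h n x - g x))\<^sup>2)" for n
  proof (rule integrableI_bounded)
    show "(\<integral>\<^sup>+x. ennreal (norm ((norm (h n x - g x))\<^sup>2)) \<partial>M) < \<infinity>"
      using fatou[of n] by (auto intro: le_less_trans)
  qed measurable
  show ?thesis
  proof (rule that[OF g])
    show "integrable M (\<lambda>x. (norm (g x))\<^sup>2)"
      using integrable_norm_powr_diff(1)[of 2 "h 0" M "\<lambda>x. h 0 x - g x"] hi[of 0] hg[of 0]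
      by (simp add: powr_numeral)
    show "(LINT x|M. (norm (h n x - g x))\<^sup>2) \<le> K * (1/16) ^ n" for n
      using fatou[of n] K nn_integral_eq_integral[OF hg[of n]] by simp
  qed
qed

lemma fourier_extension_exists:
  assumes K: "restriction_bound M p K" and p: "1 \<le> p" and f: "f \<in> Lp lborel (ereal p)"
  shows "\<exists>g. fourier_extension M (ereal p) f g"
proof -
  have fm [measurable]: "f \<in> borel_measurable borel" and fi: "integrable lborel (\<lambda>x. norm (f x) powr p)"
    using f by (auto simp: Lp_ereal_iff)
  have K0: "0 \<le> K" using K by (simp add: restriction_bound_def)
  \<comment> \<open>Solved from the requirement that the bound in
    \<open>fourier_schwartz_diff_bound\<close> be exactly K 16^(-n), the rate asked for by
    \<open>L2_limit_of_fast_Cauchy\<close>.\<close>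
  define e where "e n = ((1/16) ^ n) powr (p / 2) / (2 * 2 powr p)" for n :: nat
  have e0: "e n > 0" for n by (simp add: e_def)
  have emono: "e m \<le> e n" if "n \<le> m" for n m
    unfolding e_def using p power_decreasing[OF that, of "1/16::real"]
    by (intro divide_right_mono powr_mono2) auto
  have ee: "(2 powr p * (2 * e n)) powr (2 / p) = (1/16) ^ n" for n
    using p by (simp add: e_def powr_powr)
  have "\<exists>\<phi>. schwartz \<phi> \<and> (LINT x|lborel. norm (\<phi> x - f x) powr p) < e n" for n
    using schwartz_dense[OF p fm fi] e0 unfolding schwartz_closure_def by blast
  then obtain \<phi> where \<phi>: "\<And>n. schwartz (\<phi> n)" "\<And>n. (LINT x|lborel. norm (\<phi> n x - f x) powr p) < e n"
    by metis
  have [measurable]: "\<phi> n \<in> borel_measurable borel" for n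
    using \<phi>(1) by (rule schwartz_borel_measurable)
  define h where "h n = fourier lborel (\<phi> n)" for n
  have hm [measurable]: "h n \<in> borel_measurable borel" for n unfolding h_def by measurable
  have c: "(LINT x|M. (norm (h n x - h m x))\<^sup>2) \<le> K * (1/16) ^ n" if "n \<le> m" for n m
    unfolding h_def ee[of n, symmetric]
    using \<phi>(2)[of n] \<phi>(2)[of m] emono[OF that]
    by (intro fourier_schwartz_diff_bound[OF K p fm fi \<phi>(1) \<phi>(1)]) auto
  have hi: "integrable M (\<lambda>x. (norm (h n x))\<^sup>2)" for n
    unfolding h_def by (rule integrable_fourier_square) simp
  obtain g where g: "g \<in> borel_measurable M" "integrable M (\<lambda>x. (norm (g x))\<^sup>2)"
    "\<And>n. (LINT x|M. (norm (h n x - g x))\<^sup>2) \<le> K * (1/16) ^ n"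
    by (rule L2_limit_of_fast_Cauchy[of h K, OF _ hi K0 c]) (auto intro: that)
  have "(\<lambda>n. Lp_norm M 2 (\<lambda>x. h n x - g x)) \<longlonglongrightarrow> 0"
  proof (rule tendsto_sandwich[OF _ _ tendsto_const])
    show "\<forall>\<^sub>F n in sequentially. 0 \<le> Lp_norm M 2 (\<lambda>x. h n x - g x)"
      unfolding Lp_norm_two by simp
    show "\<forall>\<^sub>F n in sequentially. Lp_norm M 2 (\<lambda>x. h n x - g x) \<le> sqrt (K * (1/16) ^ n)"
      unfolding Lp_norm_two using g(3) by (intro always_eventually allI real_sqrt_le_mono)
    have "(\<lambda>n. sqrt (K * (1/16) ^ n)) \<longlonglongrightarrow> sqrt (K * 0)"
      by (intro tendsto_intros LIMSEQ_power_zero) simp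
    then show "(\<lambda>n. sqrt (K * (1/16) ^ n)) \<longlonglongrightarrow> 0" by simp
  qed
  moreover have "(\<lambda>n. Lp_norm lborel (ereal p) (\<lambda>x. \<phi> n x - f x)) \<longlonglongrightarrow> 0"
  proof (rule tendsto_sandwich[OF _ _ tendsto_const])
    show "\<forall>\<^sub>F n in sequentially. 0 \<le> Lp_norm lborel (ereal p) (\<lambda>x. \<phi> n x - f x)"
      by (simp add: Lp_norm_ereal)
    have "Lp_norm lborel (ereal p) (\<lambda>x. \<phi> n x - f x) \<le> (2 powr p * (2 * e n)) powr (1 / p)" for n
    proof -
      have "e n \<le> 2 powr p * (2 * e n)"
        using e0[of n] ge_one_powr_ge_zero[of 2 p] p mult_right_mono[of 1 "2 powr p * 2" "e n"] by simp
      then show ?thesis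
        unfolding Lp_norm_ereal using p \<phi>(2)[of n] by (intro powr_mono2) auto
    qed
    moreover have "(2 powr p * (2 * e n)) powr (1 / p) = sqrt ((1/16) ^ n)" for n
      unfolding ee[of n, symmetric] using e0[of n] by (simp add: powr_powr powr_half_sqrt[symmetric])
    ultimately show "\<forall>\<^sub>F n in sequentially. Lp_norm lborel (ereal p) (\<lambda>x. \<phi> n x - f x) \<le> sqrt ((1/16) ^ n)"
      by simp
    have "(\<lambda>n. sqrt ((1/16) ^ n)) \<longlonglongrightarrow> sqrt 0"
      by (intro tendsto_intros LIMSEQ_power_zero) simp
    then show "(\<lambda>n. sqrt ((1/16) ^ n)) \<longlonglongrightarrow> 0" by simp
  qed
  ultimately show ?thesis
    using f g \<phi>(1) unfolding fourier_extension_def Lp_two_iff h_def by blast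
qed

text \<open>The factor 4 is the root of 16: the quasi-triangle inequality costs 2^2 for squares in
  L^2(M) and (2^p)^(2/p) = 4 in passing from the approximants to f. The error terms vanish in the
  limit, so any approximating sequence witnessing the extension will do.\<close>

lemma fourier_extension_bound:
  assumes K: "restriction_bound M p K" and p: "1 \<le> p" and g: "fourier_extension M (ereal p) f g"
  shows "Lp_norm M 2 g \<le> 4 * sqrt K * Lp_norm lborel (ereal p) f"
proof -
  have K0: "0 \<le> K" using K by (simp add: restriction_bound_def)
  have fm [measurable]: "f \<in> borel_measurable borel" and fi: "integrable lborel (\<lambda>x. norm (f x) powr p)"
    and gm [measurable]: "g \<in> borel_measurable M" and gi: "integrable M (\<lambda>x. (norm (g x))\<^sup>2)"
    using g by (auto simp: fourier_extension_def Lp_ereal_iff Lp_two_iff)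
  obtain \<phi> where \<phi>: "\<And>n. schwartz (\<phi> n)"
    and lim1: "(\<lambda>n. Lp_norm lborel (ereal p) (\<lambda>x. \<phi> n x - f x)) \<longlonglongrightarrow> 0"
    and lim2: "(\<lambda>n. Lp_norm M 2 (\<lambda>x. fourier lborel (\<phi> n) x - g x)) \<longlonglongrightarrow> 0"
    using g unfolding fourier_extension_def by blast
  have [measurable]: "\<phi> n \<in> borel_measurable borel" for n
    using \<phi> by (rule schwartz_borel_measurable)
  define N where "N = (LINT x|lborel. norm (f x) powr p)"
  define a where "a n = (LINT x|lborel. norm (\<phi> n x - f x) powr p)" for n
  define b where "b n = (LINT x|M. (norm (fourier lborel (\<phi> n) x - g x))\<^sup>2)" for n
  have N0: "0 \<le> N" "0 \<le> a n" "0 \<le> b n" for n by (auto simp: N_def a_def b_def)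
  \<comment> \<open>The hypothesis concerns norms, hence 1/p-th powers of \<open>a\<close>; raising
    to the power p undoes this.\<close>
  have a: "a \<longlonglongrightarrow> 0"
  proof -
    have "(\<lambda>n. (a n powr (1 / p)) powr p) \<longlonglongrightarrow> 0"
      using tendsto_zero_powrI[OF lim1[unfolded Lp_norm_ereal a_def[symmetric]] tendsto_const[of p]] p
      by simp
    then show ?thesis using p N0 by (simp add: powr_powr)
  qed
  have b: "b \<longlonglongrightarrow> 0"
  proof -
    have "(\<lambda>n. (sqrt (b n))\<^sup>2) \<longlonglongrightarrow> 0\<^sup>2"
      using lim2 unfolding Lp_norm_two b_def[symmetric] by (intro tendsto_intros)
    then show ?thesis using N0 by simp
  qed
  have le: "(LINT x|M. (norm (g x))\<^sup>2) \<le> 4 * (K * (2 powr p * (a n + N)) powr (2 / p) + b n)" for n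
  proof -
    let ?h = "fourier lborel (\<phi> n)"
    have hi: "integrable M (\<lambda>x. (norm (?h x))\<^sup>2)" by (rule integrable_fourier_square) simp
    have hgi: "integrable M (\<lambda>x. (norm (?h x - g x))\<^sup>2)"
      using integrable_norm_powr_diff(1)[of 2 ?h M g] hi gi by (simp add: powr_numeral)
    have \<phi>i: "integrable lborel (\<lambda>x. norm (\<phi> n x) powr p)"
      by (rule schwartz_integrable_powr[OF \<phi> p])
    have i: "integrable lborel (\<lambda>x. norm (\<phi> n x - f x) powr p)"
      by (intro integrable_norm_powr_diff p fi \<phi>i) auto
    have 1: "(LINT x|M. (norm (g x))\<^sup>2) \<le> 4 * ((LINT x|M. (norm (?h x))\<^sup>2) + b n)"
      using integrable_norm_powr_diff(2)[of 2 ?h M "\<lambda>x. ?h x - g x"] hi hgi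
      by (simp add: powr_numeral b_def)
    have 2: "(LINT x|M. (norm (?h x))\<^sup>2) \<le> K * (LINT x|lborel. norm (\<phi> n x) powr p) powr (2 / p)"
      using K schwartz_integrable[OF \<phi>] \<phi>i by (auto simp: restriction_bound_def)
    have "(LINT x|lborel. norm (\<phi> n x) powr p) \<le> 2 powr p * (a n + N)"
      using integrable_norm_powr_add(2)[OF p _ _ i fi] by (simp add: a_def N_def)
    then have 3: "K * (LINT x|lborel. norm (\<phi> n x) powr p) powr (2 / p) \<le> K * (2 powr p * (a n + N)) powr (2 / p)"
      using p K0 by (intro mult_left_mono powr_mono2) auto
    show ?thesis
      by (rule order_trans[OF 1]) (intro mult_left_mono add_right_mono order_trans[OF 2 3], simp)
  qed
  have "(\<lambda>n. 4 * (K * (2 powr p * (a n + N)) powr (2 / p) + b n)) \<longlonglongrightarrow> 4 * (K * (2 powr p * (0 + N)) powr (2 / p) + 0)"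
    using p N0 by (intro tendsto_intros tendsto_powr' a b) (auto simp: add_nonneg_nonneg)
  then have "(LINT x|M. (norm (g x))\<^sup>2) \<le> 4 * (K * (2 powr p * (0 + N)) powr (2 / p) + 0)"
    by (rule LIMSEQ_le_const) (use le in auto)
  also have "\<dots> = 16 * (K * N powr (2 / p))"
    using p N0 by (simp add: powr_mult powr_powr powr_numeral)
  finally have "sqrt (LINT x|M. (norm (g x))\<^sup>2) \<le> sqrt (16 * (K * N powr (2 / p)))"
    by (rule real_sqrt_le_mono)
  also have "\<dots> = 4 * (sqrt K * sqrt (N powr (2 / p)))"
    unfolding real_sqrt_mult by simp
  also have "sqrt (N powr (2 / p)) = N powr (1 / p)"
    by (rule real_sqrt_unique) (unfold power2_eq_square powr_add[symmetric], simp_all)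
  finally show ?thesis
    unfolding Lp_norm_two Lp_norm_ereal N_def mult.assoc .
qed

lemma fourier_schwartz_bound:
  assumes K: "restriction_bound M p K" and p: "1 \<le> p" and f: "schwartz f"
  shows "fourier lborel f \<in> Lp M 2" and "Lp_norm M 2 (fourier lborel f) \<le> sqrt K * Lp_norm lborel (ereal p) f"
proof -
  have [measurable]: "f \<in> borel_measurable borel" by (rule schwartz_borel_measurable[OF f])
  show "fourier lborel f \<in> Lp M 2"
    unfolding Lp_two_iff by (intro conjI integrable_fourier_square) measurable
  have "(LINT \<xi>|M. (norm (fourier lborel f \<xi>))\<^sup>2) \<le> K * (LINT x|lborel. norm (f x) powr p) powr (2 / p)"
    using K schwartz_integrable[OF f] schwartz_integrable_powr[OF f p] by (auto simp: restriction_bound_def)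
  then have "sqrt (LINT \<xi>|M. (norm (fourier lborel f \<xi>))\<^sup>2) \<le> sqrt (K * (LINT x|lborel. norm (f x) powr p) powr (2 / p))"
    by (rule real_sqrt_le_mono)
  also have "\<dots> = sqrt K * sqrt ((LINT x|lborel. norm (f x) powr p) powr (2 / p))"
    by (rule real_sqrt_mult)
  also have "sqrt ((LINT x|lborel. norm (f x) powr p) powr (2 / p)) = (LINT x|lborel. norm (f x) powr p) powr (1 / p)"
    by (rule real_sqrt_unique) (unfold power2_eq_square powr_add[symmetric], simp_all)
  finally show "Lp_norm M 2 (fourier lborel f) \<le> sqrt K * Lp_norm lborel (ereal p) f"
    unfolding Lp_norm_two Lp_norm_ereal .
qed

end

section \<open>Dimensions and integrability of the transform\<close>

text \<open>Conjugacy means (x - 1)(y - 1) = 1. With w = 3 + 4D/b, one less than the threshold for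
  x, the fraction b / (4(D + b) - b) is 1/w, so the two conditions read w < x - 1 and 1/(x - 1) <
  1/w.\<close>

lemma conjugate_threshold_iff:
  fixes x y D b :: real
  assumes xy: "1 < x" "1 < y" "1 / x + 1 / y = 1" and D: "0 < D" and b: "0 < b"
  shows "4 + 4 * D / b < x \<longleftrightarrow> y < 1 + b / (4 * (D + b) - b)"
proof -
  define w where "w = 3 + 4 * D / b"
  have w: "w > 0" using D b by (simp add: w_def add_pos_pos)
  have "x + y = x * y" using xy by (simp add: field_simps)
  then have xy1: "y - 1 = 1 / (x - 1)" using xy by (simp add: field_simps)
  have "b / (4 * (D + b) - b) = 1 / w"
    using D b by (simp add: w_def field_simps)
  then have "y < 1 + b / (4 * (D + b) - b) \<longleftrightarrow> 1 / (x - 1) < 1 / w"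
    using xy1 by linarith
  also have "\<dots> \<longleftrightarrow> w < x - 1"
    using w xy by (simp add: field_simps)
  finally show ?thesis by (auto simp: w_def)
qed

lemma norm_powr_half: "norm z powr a = ((norm z)\<^sup>2) powr (a / 2)"
  using powr_powr[of "norm z" 2 "a / 2"] by simp

lemma conjugate_exponents_cases:
  assumes "conjugate_exponents q q'"
  obtains (infinity) "q = \<infinity>" "q' = 1"
    | (one) "q = 1" "q' = \<infinity>"
    | (finite) x y where "q = ereal x" "q' = ereal y" "1 < x" "1 < y" "1 / x + 1 / y = 1"
proof -
  have c: "1 \<le> q" "1 \<le> q'" "1 / q + 1 / q' = 1" using assms by (auto simp: conjugate_exponents_def)
  have one: "1 / (1::ereal) = 1" by (simp add: one_ereal_def)
  show ?thesis
  proof (cases q)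
    case (real x)
    then have x: "1 \<le> x" using c by simp
    show ?thesis
    proof (cases q')
      case (real y)
      then have y: "1 \<le> y" using c by simp
      have e: "1 / x + 1 / y = 1"
        using c(3) x y \<open>q = ereal x\<close> \<open>q' = ereal y\<close> by (simp add: one_ereal_def)
      have "1 / x > 0" "1 / y > 0" using x y by auto
      then have "1 / x < 1" "1 / y < 1" using e by linarith+
      then have "1 < x" "1 < y" using x y by auto
      then show ?thesis using finite \<open>q = ereal x\<close> \<open>q' = ereal y\<close> e by blast
    next
      case PInf
      then have "1 / x = 1" using c(3) real x by (simp add: one_ereal_def)
      then show ?thesis using that(2) real PInf x by (simp add: one_ereal_def)
    qed (use c in auto)
  next
    case PInf
    show ?thesis
    proof (cases q')
      case (real y)
      then have y: "1 \<le> y" using c by simp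
      then have "1 / y = 1" using c(3) real PInf by (simp add: one_ereal_def)
      then show ?thesis using that(1) real PInf y by (simp add: one_ereal_def)
    qed (use c PInf in auto)
  qed (use c in auto)
qed

section \<open>Exponent sets and integrability of powers of the transform\<close>

context finite_borel_measure
begin

abbreviation hat :: "'a \<Rightarrow> complex" where "hat \<equiv> fourier M (\<lambda>_. 1)"

definition decay_exponents :: "real set" where
  "decay_exponents = {t. bdd_above (range (\<lambda>\<xi>. (norm (hat \<xi>))\<^sup>2 * norm \<xi> powr t))}"

definition energy_exponents :: "real set" where
  "energy_exponents = {t. (\<integral>\<^sup>+\<xi>. ennreal ((norm (hat \<xi>))\<^sup>2 * norm \<xi> powr (t - real DIM('a))) \<partial>lborel) < \<infinity>}"

lemma fourier_dim_eq: "fourier_dim M = (SUP t\<in>decay_exponents. ereal t)"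
  by (simp add: fourier_dim_def decay_exponents_def)

lemma sobolev_dim_eq:
  "sobolev_dim M = (if energy_exponents = {} then 0 else (SUP t\<in>energy_exponents. ereal t))"
  by (simp add: sobolev_dim_def energy_exponents_def Let_def)

lemma zero_in_decay_exponents: "0 \<in> decay_exponents"
proof -
  have "(norm (hat \<xi>))\<^sup>2 * norm \<xi> powr 0 \<le> (measure M (space M))\<^sup>2" for \<xi>
    using power_mono[OF norm_transform_one_le[of \<xi>], of 2] by (cases "\<xi> = 0") auto
  then show ?thesis unfolding decay_exponents_def mem_Collect_eq by (rule bdd_aboveI2)
qed

lemma fourier_dim_nonneg: "0 \<le> fourier_dim M"
  using zero_in_decay_exponents unfolding fourier_dim_eq by (intro SUP_upper2) auto

text \<open>At the origin the defining bound gives nothing, since \<open>0 powr t\<close> is 0;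
  there the total mass bounds the transform. The weight 1 + |\<xi>| merges both regimes, and adding
  1 to the constant makes it positive.\<close>

lemma decay_of_exponent:
  assumes t: "t \<in> decay_exponents" "0 \<le> t"
  obtains C where "0 < C" "\<And>\<xi>. (norm (hat \<xi>))\<^sup>2 \<le> C * (1 + norm \<xi>) powr (- t)"
proof -
  obtain A where A: "\<And>\<xi>. (norm (hat \<xi>))\<^sup>2 * norm \<xi> powr t \<le> A"
    using t(1) unfolding decay_exponents_def bdd_above_def by auto
  define m where "m = measure M (space M)"
  have A0: "0 \<le> A" using order_trans[OF _ A[of 0]] by simp
  have C: "2 powr t * (m\<^sup>2 + A) + 1 > 0"
    using A0 by (intro add_nonneg_pos mult_nonneg_nonneg) auto
  show ?thesis
  proof (rule that[OF C])
    fix \<xi> :: 'a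
    have pos: "1 + norm \<xi> > 0" by (simp add: add_pos_nonneg)
    have "(1 + norm \<xi>) powr t \<le> (2 * max 1 (norm \<xi>)) powr t"
      using t by (intro powr_mono2) auto
    also have "\<dots> = 2 powr t * (max 1 (norm \<xi>)) powr t" by (simp add: powr_mult)
    also have "\<dots> \<le> 2 powr t * (1 + norm \<xi> powr t)"
      by (intro mult_left_mono) (auto simp: max_def)
    finally have "(norm (hat \<xi>))\<^sup>2 * (1 + norm \<xi>) powr t \<le> (norm (hat \<xi>))\<^sup>2 * (2 powr t * (1 + norm \<xi> powr t))"
      by (intro mult_left_mono) auto
    also have "\<dots> = 2 powr t * ((norm (hat \<xi>))\<^sup>2 + (norm (hat \<xi>))\<^sup>2 * norm \<xi> powr t)"
      by (simp add: algebra_simps)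
    also have "\<dots> \<le> 2 powr t * (m\<^sup>2 + A)"
      unfolding m_def using A[of \<xi>] by (intro mult_left_mono add_mono power_mono norm_transform_one_le) auto
    finally have "(norm (hat \<xi>))\<^sup>2 * (1 + norm \<xi>) powr t \<le> 2 powr t * (m\<^sup>2 + A) + 1"
      by linarith
    then show "(norm (hat \<xi>))\<^sup>2 \<le> (2 powr t * (m\<^sup>2 + A) + 1) * (1 + norm \<xi>) powr (- t)"
      using pos by (simp add: powr_minus field_simps)
  qed
qed

text \<open>A decay exponent t > d would make |h|^2 integrable. Then d itself is an energy exponent,
  its weight having exponent 0, and the Sobolev dimension is at least d.\<close>

lemma fourier_dim_finite:
  assumes "sobolev_dim M < ereal (real DIM('a))"
  shows "fourier_dim M \<le> ereal (real DIM('a))"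
proof (rule ccontr)
  assume "\<not> ?thesis"
  then obtain t where t: "t \<in> decay_exponents" "real DIM('a) < t"
    unfolding fourier_dim_eq not_le less_SUP_iff by auto
  then have "0 \<le> t" by (meson less_imp_le of_nat_0_le_iff order_trans)
  then obtain C where C: "0 < C" "\<And>\<xi>. (norm (hat \<xi>))\<^sup>2 \<le> C * (1 + norm \<xi>) powr (- t)"
    using decay_of_exponent[OF t(1)] by metis
  have i: "integrable lborel (\<lambda>\<xi>::'a. C * (1 + norm \<xi>) powr (- t))"
    using t by (intro integrable_mult_right integrable_one_plus_norm_powr)
  have "(\<integral>\<^sup>+\<xi>. ennreal ((norm (hat \<xi>))\<^sup>2 * norm \<xi> powr (real DIM('a) - real DIM('a))) \<partial>lborel)
     \<le> (\<integral>\<^sup>+(\<xi>::'a). ennreal (C * (1 + norm \<xi>) powr (- t)) \<partial>lborel)"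
  proof (intro nn_integral_mono ennreal_leI)
    fix \<xi> :: 'a
    have "(norm (hat \<xi>))\<^sup>2 * norm \<xi> powr (real DIM('a) - real DIM('a)) \<le> (norm (hat \<xi>))\<^sup>2 * 1"
      by (intro mult_left_mono) auto
    then show "(norm (hat \<xi>))\<^sup>2 * norm \<xi> powr (real DIM('a) - real DIM('a)) \<le> C * (1 + norm \<xi>) powr (- t)"
      using C(2)[of \<xi>] by linarith
  qed
  also have "\<dots> < \<infinity>"
    using nn_integral_eq_integral[OF i] C by simp
  finally have "real DIM('a) \<in> energy_exponents" by (simp add: energy_exponents_def)
  then have "ereal (real DIM('a)) \<le> sobolev_dim M"
    unfolding sobolev_dim_eq by (auto intro: SUP_upper)
  then show False using assms by simp
qed

text \<open>Decay with exponent t bounds |h|^(r-2) by a multiple of (1 + |x|)^(-t(r-2)/2), and the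
  energy integral with exponent s absorbs this once t(r-2)/2 >= d - s. At t = \<beta>, s = \<sigma>
  the hypothesis makes this strict, so it survives for nearby exponents that belong to the two
  sets.\<close>

lemma transform_integrable_powr:
  assumes \<beta>: "fourier_dim M = ereal \<beta>" "0 < \<beta>"
    and \<sigma>: "sobolev_dim M = ereal \<sigma>" "\<sigma> < real DIM('a)"
    and r: "2 + 2 * (real DIM('a) - \<sigma>) / \<beta> < r"
  shows "integrable lborel (\<lambda>x. norm (hat x) powr r)"
proof -
  let ?d = "real DIM('a)"
  have r': "?d - \<sigma> < (r - 2) * \<beta> / 2" using r \<beta> by (simp add: field_simps)
  then have "0 < (r - 2) * \<beta>" using \<sigma> by linarith
  then have r2: "r > 2" using \<beta> by (simp add: zero_less_mult_iff)
  show ?thesis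
  proof (cases "energy_exponents = {}")
    \<comment> \<open>Here \<sigma> = 0 is a convention and there is no energy to use. The threshold
      then gives \<beta> r/2 > d, so decay alone makes |h|^r integrable.\<close>
    case True
    then have "\<sigma> = 0" using \<sigma> by (simp add: sobolev_dim_eq)
    then have "2 * ?d / r < \<beta>" using r' r2 \<beta> by (simp add: field_simps)
    then have "ereal (2 * ?d / r) < (SUP t\<in>decay_exponents. ereal t)"
      using \<beta> by (simp add: fourier_dim_eq)
    then obtain t where t: "t \<in> decay_exponents" "2 * ?d / r < t"
      unfolding less_SUP_iff by auto
    have t0: "0 \<le> t" by (rule order_trans[OF _ less_imp_le[OF t(2)]]) (use r2 in simp)
    obtain C where C: "0 < C" "\<And>\<xi>. (norm (hat \<xi>))\<^sup>2 \<le> C * (1 + norm \<xi>) powr (- t)"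
      using decay_of_exponent[OF t(1) t0] by metis
    have "integrable lborel (\<lambda>x::'a. C powr (r / 2) * (1 + norm x) powr (- (t * (r / 2))))"
      using t r2 by (intro integrable_mult_right integrable_one_plus_norm_powr) (simp add: field_simps)
    then show ?thesis
    proof (rule Bochner_Integration.integrable_bound)
      have "norm (hat x) powr r \<le> C powr (r / 2) * (1 + norm x) powr (- (t * (r / 2)))" for x
      proof -
        have "norm (hat x) powr r = ((norm (hat x))\<^sup>2) powr (r / 2)"
          by (rule norm_powr_half)
        also have "\<dots> \<le> (C * (1 + norm x) powr (- t)) powr (r / 2)"
          using C r2 by (intro powr_mono2) auto
        also have "\<dots> = C powr (r / 2) * (1 + norm x) powr (- (t * (r / 2)))"
          using C by (simp add: powr_mult powr_powr)
        finally show ?thesis .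
      qed
      then show "AE x in lborel. norm (norm (hat x) powr r)
          \<le> norm (C powr (r / 2) * (1 + norm x) powr (- (t * (r / 2))))"
        by (intro always_eventually allI) (simp add: abs_mult)
    qed measurable
  next
    case False
    \<comment> \<open>An intermediate \<open>u\<close> decouples the choices: s is taken with d - s
      < u, and t with u < t(r-2)/2.\<close>
    obtain u where u: "?d - \<sigma> < u" "u < (r - 2) * \<beta> / 2" using r' dense by blast
    then have "ereal (?d - u) < (SUP t\<in>energy_exponents. ereal t)"
      using False \<sigma> by (simp add: sobolev_dim_eq)
    then obtain s where s: "s \<in> energy_exponents" "?d - u < s"
      unfolding less_SUP_iff by auto
    have "ereal s \<le> ereal \<sigma>"
      using s(1) False \<sigma>(1) unfolding sobolev_dim_eq by (metis SUP_upper)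
    then have sd: "s < ?d" using \<sigma> by simp
    have "2 * u / (r - 2) < \<beta>" using u r2 by (simp add: field_simps)
    then have "ereal (2 * u / (r - 2)) < (SUP t\<in>decay_exponents. ereal t)"
      using \<beta> by (simp add: fourier_dim_eq)
    then obtain t where t: "t \<in> decay_exponents" "2 * u / (r - 2) < t"
      unfolding less_SUP_iff by auto
    have t0: "0 \<le> t"
      by (rule order_trans[OF _ less_imp_le[OF t(2)]]) (use r2 u \<sigma> in simp)
    have tu: "u < t * ((r - 2) / 2)" using t r2 by (simp add: field_simps)
    obtain C where C: "0 < C" "\<And>\<xi>. (norm (hat \<xi>))\<^sup>2 \<le> C * (1 + norm \<xi>) powr (- t)"
      using decay_of_exponent[OF t(1) t0] by metis
    have e: "integrable lborel (\<lambda>x. (norm (hat x))\<^sup>2 * norm x powr (s - ?d))"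
      using s(1) unfolding energy_exponents_def by (intro integrableI_bounded) auto
    show ?thesis
    proof (rule Bochner_Integration.integrable_bound[OF integrable_mult_right[OF e, of "C powr ((r - 2) / 2)"]])
      \<comment> \<open>At the origin \<open>0 powr (s - ?d)\<close> is 0 despite the negative
        exponent, so the comparison may fail there.\<close>
      have "AE x in lborel. x \<noteq> (0::'a)" by (rule AE_lborel_singleton)
      then show "AE x in lborel. norm (norm (hat x) powr r)
          \<le> norm (C powr ((r - 2) / 2) * ((norm (hat x))\<^sup>2 * norm x powr (s - ?d)))"
      proof eventually_elim
        case (elim x)
        have "norm (hat x) powr r = (norm (hat x))\<^sup>2 * ((norm (hat x))\<^sup>2) powr ((r - 2) / 2)"
        proof -
          have "norm (hat x) powr r = norm (hat x) powr 2 * norm (hat x) powr (r - 2)"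
            unfolding powr_add[symmetric] by simp
          also have "norm (hat x) powr (r - 2) = ((norm (hat x))\<^sup>2) powr ((r - 2) / 2)"
            by (rule norm_powr_half)
          finally show ?thesis by (simp add: powr_numeral)
        qed
        also have "((norm (hat x))\<^sup>2) powr ((r - 2) / 2) \<le> (C * (1 + norm x) powr (- t)) powr ((r - 2) / 2)"
          using C r2 by (intro powr_mono2) auto
        also have "\<dots> = C powr ((r - 2) / 2) * (1 + norm x) powr (- (t * ((r - 2) / 2)))"
          using C by (simp add: powr_mult powr_powr)
        also have "(1 + norm x) powr (- (t * ((r - 2) / 2))) \<le> (1 + norm x) powr (s - ?d)"
          using tu s(2) by (intro powr_mono) auto
        also have "(1 + norm x) powr (s - ?d) \<le> norm x powr (s - ?d)"
          using sd elim by (intro powr_mono2') auto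
        finally have "norm (hat x) powr r \<le> (norm (hat x))\<^sup>2 * (C powr ((r - 2) / 2) * norm x powr (s - ?d))"
          by (simp add: mult_left_mono)
        then show ?case by (simp add: abs_mult ac_simps)
      qed
    qed measurable
  qed
qed

text \<open>For q = \<infinity> no decay enters: Cauchy-Schwarz against the unimodular character
  gives the square root of the total mass.\<close>

lemma extension_estimate_infinity:
  assumes f: "f \<in> Lp M 2"
  shows "fourier M f \<in> Lp lborel \<infinity>"
    and "Lp_norm lborel \<infinity> (fourier M f) \<le> sqrt (measure M (space M)) * Lp_norm M 2 f"
proof -
  have [measurable]: "f \<in> borel_measurable M" and f2: "integrable M (\<lambda>x. (norm (f x))\<^sup>2)"
    using f[unfolded Lp_two_iff] by auto
  let ?B = "sqrt (measure M (space M)) * Lp_norm M 2 f"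
  have B: "norm (fourier M f \<xi>) \<le> ?B" for \<xi>
  proof -
    have "norm (LINT x|M. wave (\<xi> \<bullet> x) * f x)
        \<le> sqrt (LINT x|M. (norm (wave (\<xi> \<bullet> x)))\<^sup>2) * sqrt (LINT x|M. (norm (f x))\<^sup>2)"
      by (rule Cauchy_Schwarz_integral_norm) (use f2 in simp_all)
    then show ?thesis unfolding Lp_norm_two fourier_eq by simp
  qed
  have B0: "0 \<le> ?B" using order_trans[OF norm_ge_zero B] .
  have le: "esssup lborel (\<lambda>x. ennreal (norm (fourier M f x))) \<le> ennreal ?B"
    using B by (intro esssup_I) (auto intro!: ennreal_leI)
  then show "fourier M f \<in> Lp lborel \<infinity>"
    by (auto simp: Lp_def intro: le_less_trans)
  show "Lp_norm lborel \<infinity> (fourier M f) \<le> ?B"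
    using enn2real_mono[OF le] B0 by (simp add: Lp_norm_def)
qed

end

section \<open>Assembly of the extension and restriction estimates\<close>

context finite_borel_measure
begin

lemma extension_theorem:
  assumes \<beta>: "fourier_dim M = ereal \<beta>" "0 < \<beta>"
    and \<sigma>: "sobolev_dim M = ereal \<sigma>" "\<sigma> < real DIM('a)"
    and q: "ereal (4 + 4 * (real DIM('a) - \<sigma>) / \<beta>) < q"
  shows "\<exists>C>0. \<forall>f\<in>Lp M 2. fourier M f \<in> Lp lborel q \<and> Lp_norm lborel q (fourier M f) \<le> C * Lp_norm M 2 f"
proof (cases q)
  case (real x)
  have pos: "4 * (real DIM('a) - \<sigma>) / \<beta> > 0" using \<beta> \<sigma> by simp
  have x: "4 + 4 * (real DIM('a) - \<sigma>) / \<beta> < x" using q real by simp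
  then have x2: "2 \<le> x" using pos by linarith
  have "2 + 2 * (real DIM('a) - \<sigma>) / \<beta> < x / 2" using x by (simp add: field_simps)
  then have h: "integrable lborel (\<lambda>\<xi>. norm (hat \<xi>) powr (x / 2))"
    by (rule transform_integrable_powr[OF \<beta> \<sigma>])
  define p where "p = x / (x - 1)"
  have xp: "1 / p + 1 / x = 1" using x2 by (simp add: p_def field_simps)
  obtain K where K: "restriction_bound M p K"
    using restriction_bound_of_transform[OF x2 xp h] by blast
  then have K0: "0 \<le> K" by (simp add: restriction_bound_def)
  show ?thesis
  \<comment> \<open>K may be 0, while the constant has to be positive.\<close>
  proof (intro exI[of _ "sqrt K + 1"] conjI ballI)
    show "sqrt K + 1 > 0" using K0 by (simp add: add_nonneg_pos)
    fix f assume f: "f \<in> Lp M 2"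
    note f' = f[unfolded Lp_two_iff, THEN conjunct1] f[unfolded Lp_two_iff, THEN conjunct2]
    note est = extension_estimate[OF x2 xp K f']
    have [measurable]: "f \<in> borel_measurable M" by (rule f'(1))
    show "fourier M f \<in> Lp lborel q"
      unfolding real Lp_ereal_iff using est(1) by simp
    have "Lp_norm lborel q (fourier M f) \<le> sqrt K * Lp_norm M 2 f"
      unfolding real Lp_norm_ereal Lp_norm_two by (rule est(2))
    also have "\<dots> \<le> (sqrt K + 1) * Lp_norm M 2 f"
      unfolding Lp_norm_two by (intro mult_right_mono) auto
    finally show "Lp_norm lborel q (fourier M f) \<le> (sqrt K + 1) * Lp_norm M 2 f" .
  qed
next
  case PInf
  show ?thesis
  proof (intro exI[of _ "sqrt (measure M (space M)) + 1"] conjI ballI)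
    show "sqrt (measure M (space M)) + 1 > 0" by (simp add: add_nonneg_pos)
    fix f assume f: "f \<in> Lp M 2"
    show "fourier M f \<in> Lp lborel q"
      unfolding PInf by (rule extension_estimate_infinity[OF f])
    have "Lp_norm lborel q (fourier M f) \<le> sqrt (measure M (space M)) * Lp_norm M 2 f"
      unfolding PInf by (rule extension_estimate_infinity[OF f])
    also have "\<dots> \<le> (sqrt (measure M (space M)) + 1) * Lp_norm M 2 f"
      unfolding Lp_norm_two by (intro mult_right_mono) auto
    finally show "Lp_norm lborel q (fourier M f) \<le> (sqrt (measure M (space M)) + 1) * Lp_norm M 2 f" .
  qed
qed (use q in simp)

text \<open>For p > 1 the condition is translated to the conjugate exponent, where half the
  threshold is the one for integrability of the transform. One constant serves both claims; the
  factor 4 is needed for the extension by density.\<close>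

lemma restriction_theorem:
  assumes \<beta>: "fourier_dim M = ereal \<beta>" "0 < \<beta>"
    and \<sigma>: "sobolev_dim M = ereal \<sigma>" "\<sigma> < real DIM('a)"
    and p: "1 \<le> p" "p < 1 + \<beta> / (4 * (real DIM('a) - \<sigma> + \<beta>) - \<beta>)"
  shows "\<exists>C>0. (\<forall>f. schwartz f \<longrightarrow> fourier lborel f \<in> Lp M 2 \<and>
                Lp_norm M 2 (fourier lborel f) \<le> C * Lp_norm lborel (ereal p) f) \<and>
             (\<forall>f\<in>Lp lborel (ereal p). (\<exists>g. fourier_extension M (ereal p) f g) \<and>
                (\<forall>g. fourier_extension M (ereal p) f g \<longrightarrow> Lp_norm M 2 g \<le> C * Lp_norm lborel (ereal p) f))"
proof -
  have "\<exists>K. restriction_bound M p K"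
  proof (cases "p = 1")
    case True
    then show ?thesis using restriction_bound_one by blast
  next
    case False
    then have p1: "1 < p" using p by simp
    define x where "x = p / (p - 1)"
    have xp: "1 / p + 1 / x = 1" using p1 by (simp add: x_def field_simps)
    have x1: "1 < x" using p1 by (simp add: x_def)
    have x: "4 + 4 * (real DIM('a) - \<sigma>) / \<beta> < x"
      using conjugate_threshold_iff[OF x1 p1 _ _ \<beta>(2), of "real DIM('a) - \<sigma>"] p \<sigma> xp
      by (simp add: add.commute)
    have pos: "4 * (real DIM('a) - \<sigma>) / \<beta> > 0" using \<beta> \<sigma> by simp
    then have x2: "2 \<le> x" using x by linarith
    have "2 + 2 * (real DIM('a) - \<sigma>) / \<beta> < x / 2" using x by (simp add: field_simps)
    then have "integrable lborel (\<lambda>\<xi>. norm (hat \<xi>) powr (x / 2))"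
      by (rule transform_integrable_powr[OF \<beta> \<sigma>])
    then show ?thesis by (rule restriction_bound_of_transform[OF x2 xp])
  qed
  then obtain K where K: "restriction_bound M p K" by blast
  then have K0: "0 \<le> K" by (simp add: restriction_bound_def)
  have N0: "0 \<le> Lp_norm lborel (ereal p) f" for f :: "'a \<Rightarrow> complex"
    by (simp add: Lp_norm_ereal)
  show ?thesis
  proof (intro exI[of _ "4 * sqrt K + 1"] conjI ballI allI impI)
    show "4 * sqrt K + 1 > 0" using K0 by (simp add: add_nonneg_pos)
  next
    fix f :: "'a \<Rightarrow> complex" assume f: "schwartz f"
    show "fourier lborel f \<in> Lp M 2" by (rule fourier_schwartz_bound[OF K p(1) f])
    have "Lp_norm M 2 (fourier lborel f) \<le> sqrt K * Lp_norm lborel (ereal p) f"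
      by (rule fourier_schwartz_bound[OF K p(1) f])
    also have "\<dots> \<le> (4 * sqrt K + 1) * Lp_norm lborel (ereal p) f"
      using K0 by (intro mult_right_mono N0) simp
    finally show "Lp_norm M 2 (fourier lborel f) \<le> (4 * sqrt K + 1) * Lp_norm lborel (ereal p) f" .
  next
    fix f :: "'a \<Rightarrow> complex" assume "f \<in> Lp lborel (ereal p)"
    then show "\<exists>g. fourier_extension M (ereal p) f g"
      by (rule fourier_extension_exists[OF K p(1)])
  next
    fix f g :: "'a \<Rightarrow> complex" assume "fourier_extension M (ereal p) f g"
    then have "Lp_norm M 2 g \<le> 4 * sqrt K * Lp_norm lborel (ereal p) f"
      by (rule fourier_extension_bound[OF K p(1)])
    also have "\<dots> \<le> (4 * sqrt K + 1) * Lp_norm lborel (ereal p) f"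
      by (intro mult_right_mono N0) simp
    finally show "Lp_norm M 2 g \<le> (4 * sqrt K + 1) * Lp_norm lborel (ereal p) f" .
  qed
qed

end

theorem corollary6p1:
  fixes M :: "'a::euclidean_space measure"
  assumes "finite_measure M"
    and "sets M = sets borel"
    and "emeasure M (space M) \<noteq> 0"
    and "\<exists>K. compact K \<and> emeasure M (- K) = 0"
    and "sobolev_dim M < ereal (real DIM('a))"
  shows
    "let d = ereal (real DIM('a)); s = sobolev_dim M; \<beta> = fourier_dim M in
       (\<forall>q::ereal. q > 4 + 4 * (d - s) / \<beta> \<longrightarrow>
          (\<exists>C>0. \<forall>f\<in>Lp M 2.
             fourier M f \<in> Lp lborel q \<and> Lp_norm lborel q (fourier M f) \<le> C * Lp_norm M 2 f)) \<and>
       (\<forall>q'::ereal. 1 \<le> q' \<and> q' < 1 + \<beta> / (4 * (d - s + \<beta>) - \<beta>) \<longrightarrow>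
          (\<exists>C>0.
             (\<forall>f. schwartz f \<longrightarrow>
                fourier lborel f \<in> Lp M 2 \<and>
                Lp_norm M 2 (fourier lborel f) \<le> C * Lp_norm lborel q' f) \<and>
             (\<forall>f\<in>Lp lborel q'.
                (\<exists>g. fourier_extension M q' f g) \<and>
                (\<forall>g. fourier_extension M q' f g \<longrightarrow>
                   Lp_norm M 2 g \<le> C * Lp_norm lborel q' f)))) \<and>
       (\<forall>q q'. conjugate_exponents q q' \<longrightarrow>
          (q > 4 + 4 * (d - s) / \<beta> \<longleftrightarrow> 1 \<le> q' \<and> q' < 1 + \<beta> / (4 * (d - s + \<beta>) - \<beta>)))"
proof -
  interpret finite_borel_measure M
    using assms by (simp add: finite_borel_measure_def finite_borel_measure_axioms_def)
  let ?d = "real DIM('a)"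
  \<comment> \<open>Both dimensions are shown to be real so that the extended arithmetic of the
    thresholds reduces to real arithmetic. Here an element of the exponent set excludes
    -\<infinity>, and the empty set gives 0 by convention.\<close>
  obtain \<sigma> where \<sigma>: "sobolev_dim M = ereal \<sigma>"
  proof (cases "energy_exponents = {}")
    case True
    then show ?thesis using that[of 0] by (simp add: sobolev_dim_eq zero_ereal_def)
  next
    case False
    then obtain t where "t \<in> energy_exponents" by blast
    then have "ereal t \<le> sobolev_dim M" using False by (auto simp: sobolev_dim_eq intro: SUP_upper)
    then show ?thesis using assms(5) that by (cases "sobolev_dim M") auto
  qed
  then have \<sigma>d: "\<sigma> < ?d" using assms(5) by simp
  obtain \<beta> where \<beta>: "fourier_dim M = ereal \<beta>" "0 \<le> \<beta>"
    using fourier_dim_nonneg fourier_dim_finite[OF assms(5)] by (cases "fourier_dim M") auto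
  have four: "(4::ereal) = ereal 4" by simp
  \<comment> \<open>For \<beta> = 0 a positive number is divided by zero, which is \<infinity> in
    \<open>ereal\<close>; no q exceeds it.\<close>
  have thr: "4 + 4 * (ereal ?d - ereal \<sigma>) / ereal \<beta> = (if \<beta> = 0 then \<infinity> else ereal (4 + 4 * (?d - \<sigma>) / \<beta>))"
    unfolding four using \<sigma>d by (simp add: ereal_divide)
  \<comment> \<open>The denominator is 4(d - \<sigma>) + 3\<beta> > 0. For \<beta> = 0 the threshold
    is 1, and no q' satisfies both conditions.\<close>
  have thr': "1 + ereal \<beta> / (4 * (ereal ?d - ereal \<sigma> + ereal \<beta>) - ereal \<beta>)
      = ereal (1 + \<beta> / (4 * (?d - \<sigma> + \<beta>) - \<beta>))"
    unfolding four using \<sigma>d \<beta> by (simp add: one_ereal_def)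
  show ?thesis
    unfolding Let_def \<sigma> \<beta>(1) thr thr'
  proof (intro conjI allI impI)
    fix q :: ereal
    assume q: "(if \<beta> = 0 then \<infinity> else ereal (4 + 4 * (?d - \<sigma>) / \<beta>)) < q"
    then have "0 < \<beta>" using \<beta>(2) by (cases "\<beta> = 0") auto
    then show "\<exists>C>0. \<forall>f\<in>Lp M 2. fourier M f \<in> Lp lborel q \<and> Lp_norm lborel q (fourier M f) \<le> C * Lp_norm M 2 f"
      using q by (intro extension_theorem[OF \<beta>(1) _ \<sigma> \<sigma>d]) auto
  next
    fix q' :: ereal
    assume q': "1 \<le> q' \<and> q' < ereal (1 + \<beta> / (4 * (?d - \<sigma> + \<beta>) - \<beta>))"
    then obtain p where p: "q' = ereal p" by (cases q') auto
    have p1: "1 \<le> p" "p < 1 + \<beta> / (4 * (?d - \<sigma> + \<beta>) - \<beta>)" using q' p by auto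
    then have "0 < \<beta>" using \<beta>(2) by (cases "\<beta> = 0") auto
    then show "\<exists>C>0.
             (\<forall>f. schwartz f \<longrightarrow>
                fourier lborel f \<in> Lp M 2 \<and>
                Lp_norm M 2 (fourier lborel f) \<le> C * Lp_norm lborel q' f) \<and>
             (\<forall>f\<in>Lp lborel q'.
                (\<exists>g. fourier_extension M q' f g) \<and>
                (\<forall>g. fourier_extension M q' f g \<longrightarrow>
                   Lp_norm M 2 g \<le> C * Lp_norm lborel q' f))"
      unfolding p by (intro restriction_theorem[OF \<beta>(1) _ \<sigma> \<sigma>d p1])
  next
    fix q q' :: ereal
    assume "conjugate_exponents q q'"
    then show "(if \<beta> = 0 then \<infinity> else ereal (4 + 4 * (?d - \<sigma>) / \<beta>)) < q
      \<longleftrightarrow> 1 \<le> q' \<and> q' < ereal (1 + \<beta> / (4 * (?d - \<sigma> + \<beta>) - \<beta>))"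
    proof (cases rule: conjugate_exponents_cases)
      case infinity
      \<comment> \<open>For q = \<infinity> and q' = 1 both conditions amount to \<beta> >
        0.\<close>
      have "0 < \<beta> / (4 * (?d - \<sigma> + \<beta>) - \<beta>)" if "\<beta> \<noteq> 0"
        using that \<beta>(2) \<sigma>d by (intro divide_pos_pos) auto
      then show ?thesis using infinity by (auto simp: one_ereal_def)
    next
      case one
      \<comment> \<open>For q = 1 and q' = \<infinity> both conditions fail: the first threshold is
        at least 4 and the second is finite.\<close>
      have "0 \<le> 4 * (?d - \<sigma>) / \<beta>" using \<beta>(2) \<sigma>d by simp
      then have "\<not> 4 + 4 * (?d - \<sigma>) / \<beta> < 1" by linarith
      then show ?thesis using one by (auto simp: one_ereal_def)
    next
      case (finite x y)
      show ?thesis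
      proof (cases "\<beta> = 0")
        case True
        then show ?thesis using finite by simp
      next
        case False
        then show ?thesis
          using conjugate_threshold_iff[OF finite(3,4,5), of "?d - \<sigma>" \<beta>] \<beta>(2) \<sigma>d finite by simp
      qed
    qed
  qed
qed

end
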